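(* Let $A,M,B,P,R$ be as in the context, and suppose that $\|I-M^{-1}A\|_B<1$, that $M^{-1}A$ is $B$-normal, and that $I-M^{-1}A$ is nonsingular. Let $\Pi_A$ be a $B$-orthogonal projection with $\Pi_A\ne0$ and $\Pi_A\ne I_n$, and let $\nu\in\mathbb{N}$. Then $$\|E^{\nu,\nu}\|_B=\|E^{\nu,0}\|_B^2=\|E^{0,\nu}\|_B^2=1-\lambda_{min}^+\bigl(\widehat X^{-1}B(I-\Pi_A)\bigr),$$ where $\widehat X^{-1}B=I-(I-\widehat M^{-1}B)^\nu$ and $\lambda_{min}^+(\widehat X^{-1}B(I-\Pi_A))\in(0,1)$. Additionally, $\widehat X^{-1}B$ is $B$-orthogonal, $\widehat X^{-1}$ is Hermitian positive definite, and $\sigma(\widehat X^{-1}B(I-\Pi_A))\subseteq[0,1)$.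
   Context: $A\in\mathbb{C}^{n\times n}$ is nonsingular, $M^{-1}\in\mathbb{C}^{n\times n}$ is nonsingular, and $B\in\mathbb{C}^{n\times n}$ is Hermitian positive definite (HPD). $\|x\|_B=\sqrt{x^HBx}$ and $\|C\|_B=\sup_{x\ne0}\|Cx\|_B/\|x\|_B$. The $B$-adjoint of $C\in\mathbb{C}^{n\times n}$ is $C^+=B^{-1}C^HB$; $C$ is $B$-normal if $CC^+=C^+C$ and $B$-orthogonal if $C^+=C$. $\sigma$ denotes the spectrum; for a matrix with real eigenvalues, $\lambda_{min}^+$ denotes its smallest positive eigenvalue. $\mathbb{N}=\{1,2,\dots\}$. $P,R\in\mathbb{C}^{n\times n_c}$, $n_c<n$, are such that $R^HAP$ is nonsingular, and $\Pi_A=P(R^HAP)^{-1}R^HA$ (a projection). The error propagation matrices are, for $\nu_1,\nu_2\in\mathbb{N}_0$, $$E^{\nu_1,\nu_2}=(I-M^{-1}A)^{\nu_2}(I-\Pi_A)(I-M^{-1}A)^{\nu_1}.$$ The matrix $\widehat M^{-1}$ is defined by $\widehat M^{-1}=M^{-1}AB^{-1}+B^{-1}A^HM^{-H}-M^{-1}AB^{-1}A^HM^{-H}$, so that $I-\widehat M^{-1}B=(I-M^{-1}A)(I-M^{-1}A)^+$. *)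

theory Defs
  imports
    "Jordan_Normal_Form.Spectral_Radius"
    "Jordan_Normal_Form.Gauss_Jordan_Elimination"
begin

(* Meaningful only for nonsingular square matrices; otherwise unspecified. *)
definition mat_inv :: "complex mat \<Rightarrow> complex mat" where
  "mat_inv A = the (mat_inverse A)"

(* The term (B *\<^sub>v x) \<bullet>c x is x^H B x.  The order on complex numbers is that of
   HOL-Library.Complex_Order, so 0 < z says that z is real and positive. *)
definition hpd :: "complex mat \<Rightarrow> bool" where
  "hpd B \<longleftrightarrow> square_mat B \<and> mat_adjoint B = B \<and>
     (\<forall>x \<in> carrier_vec (dim_row B). x \<noteq> 0\<^sub>v (dim_row B) \<longrightarrow> 0 < (B *\<^sub>v x) \<bullet>c x)"

definition vec_norm_B :: "complex mat \<Rightarrow> complex vec \<Rightarrow> real" where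
  "vec_norm_B B x = sqrt (Re ((B *\<^sub>v x) \<bullet>c x))"

definition mat_norm_B :: "complex mat \<Rightarrow> complex mat \<Rightarrow> real" where
  "mat_norm_B B C =
     (SUP x \<in> {x \<in> carrier_vec (dim_row B). x \<noteq> 0\<^sub>v (dim_row B)}.
        vec_norm_B B (C *\<^sub>v x) / vec_norm_B B x)"

definition adjoint_B :: "complex mat \<Rightarrow> complex mat \<Rightarrow> complex mat" where
  "adjoint_B B C = mat_inv B * mat_adjoint C * B"

definition normal_B :: "complex mat \<Rightarrow> complex mat \<Rightarrow> bool" where
  "normal_B B C \<longleftrightarrow> C * adjoint_B B C = adjoint_B B C * C"

(* "B-orthogonal" means self-adjoint in the B-inner product (as for orthogonal projections),
   not norm-preserving. *)
definition orthogonal_B :: "complex mat \<Rightarrow> complex mat \<Rightarrow> bool" where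
  "orthogonal_B B C \<longleftrightarrow> adjoint_B B C = C"

(* Meaningful only if C has a positive eigenvalue; Min of the empty set is unspecified. *)
definition lambda_min_pos :: "complex mat \<Rightarrow> real" where
  "lambda_min_pos C = Min {r. 0 < r \<and> complex_of_real r \<in> spectrum C}"

definition Pi_proj :: "complex mat \<Rightarrow> complex mat \<Rightarrow> complex mat \<Rightarrow> complex mat" where
  "Pi_proj A P R = P * mat_inv (mat_adjoint R * A * P) * mat_adjoint R * A"

definition smoother :: "complex mat \<Rightarrow> complex mat \<Rightarrow> complex mat" where
  "smoother A M = 1\<^sub>m (dim_row A) - mat_inv M * A"

definition err_prop ::
  "complex mat \<Rightarrow> complex mat \<Rightarrow> complex mat \<Rightarrow> complex mat \<Rightarrow> nat \<Rightarrow> nat \<Rightarrow> complex mat" where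
  "err_prop A M P R \<nu>1 \<nu>2 =
     (smoother A M ^\<^sub>m \<nu>2) * (1\<^sub>m (dim_row A) - Pi_proj A P R) * (smoother A M ^\<^sub>m \<nu>1)"

definition Mhat_inv :: "complex mat \<Rightarrow> complex mat \<Rightarrow> complex mat \<Rightarrow> complex mat" where
  "Mhat_inv A M B =
     mat_inv M * A * mat_inv B
     + mat_inv B * mat_adjoint A * mat_adjoint (mat_inv M)
     - mat_inv M * A * mat_inv B * mat_adjoint A * mat_adjoint (mat_inv M)"

(* The matrix determined by Xhat_inv * B = I - (I - Mhat_inv * B)^\<nu>, solved for Xhat_inv. *)
definition Xhat_inv :: "complex mat \<Rightarrow> complex mat \<Rightarrow> complex mat \<Rightarrow> nat \<Rightarrow> complex mat" where
  "Xhat_inv A M B \<nu> =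
     (1\<^sub>m (dim_row A) - (1\<^sub>m (dim_row A) - Mhat_inv A M B * B) ^\<^sub>m \<nu>) * mat_inv B"

end

theory Submission
  imports Defs
begin

text \<open>
  Work in the inner product of \<open>B\<close>.  Let \<open>G\<close> be the smoother \<open>1 - mat_inv M * A\<close>,
  \<open>S\<close> its \<open>\<nu>\<close>-th power and \<open>Q = 1 - Pi_proj A P R\<close>, an orthogonal projection.  The three
  error propagators are \<open>S Q S\<close>, \<open>Q S\<close> and \<open>S Q\<close>.

  The matrix \<open>S\<close> is normal along with \<open>mat_inv M * A\<close>, so \<open>S\<close> and its adjoint
  \<open>S\<^sup>+\<close> map every vector to vectors of equal norm, and one may be exchanged for the other on
  the left of a product inside a norm.  Together with \<open>\<parallel>C\<^sup>+\<parallel> = \<parallel>C\<parallel>\<close> and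
  \<open>\<parallel>C\<^sup>+ C\<parallel> = \<parallel>C\<parallel>\<^sup>2\<close> this gives the equalities between the norms
  (\<open>normal_B_projection_norms\<close>).

  Normality also gives \<open>(1 - Mhat_inv A M B * B) ^ \<nu> = (G G\<^sup>+) ^ \<nu> = S\<^sup>+ S\<close>, so
  \<open>X B = 1 - S\<^sup>+ S\<close>.  This is self-adjoint, positive definite because \<open>S\<close> is a strict
  contraction, and below the identity because \<open>S\<close> is injective.  Multiplying by \<open>Q\<close>
  yields a matrix whose nonzero eigenvalues are those of the compression
  \<open>Q (1 - S\<^sup>+ S) Q\<close> to the range of \<open>Q\<close>.  There
  \<open>Q S\<^sup>+ S Q = (S Q)\<^sup>+ (S Q)\<close> has largest eigenvalue \<open>\<parallel>S Q\<parallel>\<^sup>2\<close>, so the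
  smallest positive eigenvalue is \<open>1 - \<parallel>S Q\<parallel>\<^sup>2\<close>
  (\<open>compressed_smallest_eigenvalue\<close>, \<open>compressed_nonzero_eigenvalue\<close>).

  All of this rests on one spectral fact, \<open>orthogonal_B_max_eigenvalue\<close>: the largest eigenvalue
  of a self-adjoint matrix bounds its Rayleigh quotient.  It makes the supremum that defines the
  matrix norm finite and attained.  Its proof strips linear factors from an annihilating product
  of \<open>T - a\<close>, splitting off an eigenvector orthogonally in each step.
\<close>

section \<open>Adjoints and inverses of matrices\<close>

lemma mat_adjoint_index [simp]:
  fixes A :: "complex mat"
  shows "dim_row (mat_adjoint A) = dim_col A" "dim_col (mat_adjoint A) = dim_row A"
    and "i < dim_col A \<Longrightarrow> j < dim_row A \<Longrightarrow> mat_adjoint A $$ (i, j) = cnj (A $$ (j, i))"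
  unfolding mat_adjoint_def by (auto simp: mat_of_rows_index)

lemma mat_adjoint_carrier [simp]:
  fixes A :: "complex mat"
  assumes "A \<in> carrier_mat m k"
  shows "mat_adjoint A \<in> carrier_mat k m"
  using assms by auto

lemma cscalar_prod_mat_adjoint:
  fixes A :: "complex mat"
  assumes A: "A \<in> carrier_mat m k" and x: "x \<in> carrier_vec k" and y: "y \<in> carrier_vec m"
  shows "(A *\<^sub>v x) \<bullet>c y = x \<bullet>c (mat_adjoint A *\<^sub>v y)"
proof -
  have "(A *\<^sub>v x) \<bullet>c y = (\<Sum>i<m. \<Sum>j<k. A $$ (i, j) * x $ j * cnj (y $ i))"
    using A x y by (auto simp: scalar_prod_def sum_distrib_right lessThan_atLeast0 intro!: sum.cong)
  also have "\<dots> = (\<Sum>j<k. \<Sum>i<m. A $$ (i, j) * x $ j * cnj (y $ i))"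
    by (rule sum.swap)
  also have "\<dots> = x \<bullet>c (mat_adjoint A *\<^sub>v y)"
    using A x y
    by (auto simp: scalar_prod_def sum_distrib_left lessThan_atLeast0 ac_simps intro!: sum.cong)
  finally show ?thesis .
qed

lemma mat_adjoint_mult:
  fixes A C :: "complex mat"
  assumes "A \<in> carrier_mat m k" "C \<in> carrier_mat k l"
  shows "mat_adjoint (A * C) = mat_adjoint C * mat_adjoint A"
  using assms
  by (intro eq_matI) (auto simp: scalar_prod_def intro!: sum.cong)

lemma vec_diff_zeroD:
  fixes u v :: "complex vec"
  assumes u: "u \<in> carrier_vec n" and v: "v \<in> carrier_vec n" and d: "u - v = 0\<^sub>v n"
  shows "u = v"
proof (rule eq_vecI)
  fix i assume "i < dim_vec v"
  then show "u $ i = v $ i"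
    using arg_cong[OF d, of "\<lambda>w. w $ i"] u v by simp
qed (use u v in auto)

lemma mat_inv:
  assumes A: "A \<in> carrier_mat n n" and inv: "invertible_mat A"
  shows mat_inv_carrier: "mat_inv A \<in> carrier_mat n n"
    and mat_inv_right: "A * mat_inv A = 1\<^sub>m n"
    and mat_inv_left: "mat_inv A * A = 1\<^sub>m n"
proof -
  obtain C where C: "inverts_mat A C" "inverts_mat C A"
    using inv unfolding invertible_mat_def by blast
  have AC: "A * C = 1\<^sub>m n" using C A unfolding inverts_mat_def by simp
  have "dim_row C = n"
    using C A unfolding inverts_mat_def by (metis carrier_matD(2) index_mult_mat(3) index_one_mat(3))
  moreover have "dim_col C = n"
    using AC by (metis index_mult_mat(3) index_one_mat(3))
  ultimately have Cc: "C \<in> carrier_mat n n" and CA: "C * A = 1\<^sub>m n"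
    using C unfolding inverts_mat_def by auto
  have "A \<in> Units (ring_mat TYPE(complex) n ())"
    unfolding Units_def ring_mat_def using A Cc CA AC by auto
  then obtain D where D: "mat_inverse A = Some D"
    using mat_inverse(1)[OF A, of "()"] by (cases "mat_inverse A") auto
  then show "mat_inv A \<in> carrier_mat n n" "A * mat_inv A = 1\<^sub>m n" "mat_inv A * A = 1\<^sub>m n"
    using mat_inverse(2)[OF A D] unfolding mat_inv_def by auto
qed

section \<open>The inner product of a Hermitian positive definite matrix\<close>

locale hpd_form =
  fixes B :: "complex mat" and n :: nat
  assumes B_carrier [simp]: "B \<in> carrier_mat n n"
    and B_hpd: "hpd B"
begin

definition ip :: "complex vec \<Rightarrow> complex vec \<Rightarrow> complex" where
  "ip x y = (B *\<^sub>v x) \<bullet>c y"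

abbreviation nrm :: "complex vec \<Rightarrow> real" where
  "nrm \<equiv> vec_norm_B B"

lemma B_adjoint: "mat_adjoint B = B"
  using B_hpd unfolding hpd_def by simp

lemma dim_B [simp]: "dim_row B = n" "dim_col B = n"
  by (rule carrier_matD[OF B_carrier])+

lemma mult_vec_carrier [simp]:
  fixes C :: "complex mat"
  shows "C \<in> carrier_mat n n \<Longrightarrow> x \<in> carrier_vec n \<Longrightarrow> C *\<^sub>v x \<in> carrier_vec n"
  by (rule mult_mat_vec_carrier)

lemma mult_mat_closed [simp]:
  fixes C D :: "complex mat"
  shows "C \<in> carrier_mat n n \<Longrightarrow> D \<in> carrier_mat n n \<Longrightarrow> C * D \<in> carrier_mat n n"
  by (rule mult_carrier_mat)

lemma mult_mult_vec [simp]: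
  fixes C D :: "complex mat"
  shows "C \<in> carrier_mat n n \<Longrightarrow> D \<in> carrier_mat n n \<Longrightarrow> x \<in> carrier_vec n
    \<Longrightarrow> C * D *\<^sub>v x = C *\<^sub>v (D *\<^sub>v x)"
  by (rule assoc_mult_mat_vec)

lemma square_mat_simps [simp]:
  fixes C D :: "complex mat" and x :: "complex vec"
  shows "C \<in> carrier_mat n n \<Longrightarrow> D \<in> carrier_mat n n \<Longrightarrow> C - D \<in> carrier_mat n n"
    and "C \<in> carrier_mat n n \<Longrightarrow> 1\<^sub>m n * C = C"
    and "C \<in> carrier_mat n n \<Longrightarrow> C * 1\<^sub>m n = C"
    and "C \<in> carrier_mat n n \<Longrightarrow> C *\<^sub>v 0\<^sub>v n = 0\<^sub>v n"
    and "x \<in> carrier_vec n \<Longrightarrow> 0\<^sub>m n n *\<^sub>v x = 0\<^sub>v n"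
  by (auto intro!: minus_carrier_mat)

lemma ip_alt:
  assumes "x \<in> carrier_vec n" "y \<in> carrier_vec n"
  shows "ip x y = x \<bullet>c (B *\<^sub>v y)"
  unfolding ip_def using cscalar_prod_mat_adjoint[OF B_carrier assms] B_adjoint by simp

lemma ip_commute:
  assumes "x \<in> carrier_vec n" "y \<in> carrier_vec n"
  shows "ip y x = cnj (ip x y)"
proof -
  have "cnj (ip x y) = conjugate (x \<bullet>c (B *\<^sub>v y))"
    using ip_alt[OF assms] by simp
  also have "\<dots> = conjugate x \<bullet> (B *\<^sub>v y)"
    using assms by (subst conjugate_sprod_vec[of _ n]) auto
  also have "\<dots> = ip y x"
    unfolding ip_def using assms by (intro conjugate_vec_sprod_comm[symmetric]) auto
  finally show ?thesis by simp
qed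

lemma ip_add_left:
  assumes "x \<in> carrier_vec n" "y \<in> carrier_vec n" "z \<in> carrier_vec n"
  shows "ip (x + y) z = ip x z + ip y z"
  unfolding ip_def using assms
  by (simp add: mult_add_distrib_mat_vec[of _ n n] add_scalar_prod_distrib[of _ n])

lemma ip_diff_left:
  assumes "x \<in> carrier_vec n" "y \<in> carrier_vec n" "z \<in> carrier_vec n"
  shows "ip (x - y) z = ip x z - ip y z"
  unfolding ip_def using assms
  by (simp add: mult_minus_distrib_mat_vec[of _ n n] minus_scalar_prod_distrib[of _ n])

lemma ip_smult_left:
  assumes "x \<in> carrier_vec n" "z \<in> carrier_vec n"
  shows "ip (c \<cdot>\<^sub>v x) z = c * ip x z"
  unfolding ip_def using assms
  by (simp add: mult_mat_vec[of _ n n] smult_scalar_prod_distrib[of _ n])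

lemma ip_add_right:
  assumes "x \<in> carrier_vec n" "y \<in> carrier_vec n" "z \<in> carrier_vec n"
  shows "ip z (x + y) = ip z x + ip z y"
  using assms by (simp add: ip_commute[of _ z] ip_add_left)

lemma ip_diff_right:
  assumes "x \<in> carrier_vec n" "y \<in> carrier_vec n" "z \<in> carrier_vec n"
  shows "ip z (x - y) = ip z x - ip z y"
  using assms by (simp add: ip_commute[of _ z] ip_diff_left)

lemma ip_smult_right:
  assumes "x \<in> carrier_vec n" "z \<in> carrier_vec n"
  shows "ip z (c \<cdot>\<^sub>v x) = cnj c * ip z x"
  using assms by (simp add: ip_commute[of _ z] ip_smult_left)

lemma ip_zero_left [simp]: "z \<in> carrier_vec n \<Longrightarrow> ip (0\<^sub>v n) z = 0"
  using ip_diff_left[of z z z] by simp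

lemmas ip_lin = ip_add_left ip_diff_left ip_smult_left ip_add_right ip_diff_right ip_smult_right

lemma ip_pos:
  assumes "x \<in> carrier_vec n" "x \<noteq> 0\<^sub>v n"
  shows "0 < ip x x"
  using assms B_hpd unfolding hpd_def ip_def by simp

lemma ip_self_nonneg: "x \<in> carrier_vec n \<Longrightarrow> 0 \<le> ip x x"
  using ip_pos[of x] by (cases "x = 0\<^sub>v n") auto

lemma ip_self:
  assumes "x \<in> carrier_vec n"
  shows "ip x x = complex_of_real ((nrm x)\<^sup>2)"
proof -
  have "Im (ip x x) = 0" "0 \<le> Re (ip x x)"
    using ip_self_nonneg[OF assms] by (auto simp: less_eq_complex_def)
  then show ?thesis
    unfolding vec_norm_B_def ip_def[symmetric] by (auto simp: complex_eq_iff)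
qed

lemma ip_self_eq_0_iff:
  assumes "x \<in> carrier_vec n"
  shows "ip x x = 0 \<longleftrightarrow> x = 0\<^sub>v n"
  using ip_pos[of x] assms by (cases "x = 0\<^sub>v n") auto

lemma nrm_nonneg [simp]: "x \<in> carrier_vec n \<Longrightarrow> 0 \<le> nrm x"
  unfolding vec_norm_B_def ip_def[symmetric] using ip_self_nonneg
  by (auto simp: less_eq_complex_def)

lemma nrm_pos:
  assumes "x \<in> carrier_vec n" "x \<noteq> 0\<^sub>v n"
  shows "0 < nrm x"
  using assms ip_self[OF assms(1)] ip_self_eq_0_iff[OF assms(1)] nrm_nonneg[OF assms(1)]
  by (cases "nrm x = 0") (auto simp: less_le)

lemma nrm_zero [simp]: "nrm (0\<^sub>v n) = 0"
  unfolding vec_norm_B_def ip_def[symmetric] by simp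

text \<open>The real part of the Cauchy--Schwarz inequality follows by expanding the square norm of
  \<open>nrm y \<cdot> x - nrm x \<cdot> y\<close>, which is
  \<open>2 \<cdot> nrm x \<cdot> nrm y \<cdot> (nrm x \<cdot> nrm y - Re (ip x y))\<close>.\<close>

lemma Re_ip_le:
  assumes x: "x \<in> carrier_vec n" and y: "y \<in> carrier_vec n"
  shows "Re (ip x y) \<le> nrm x * nrm y"
proof (cases "x = 0\<^sub>v n \<or> y = 0\<^sub>v n")
  case True
  then show ?thesis using x y ip_commute[OF y x] by auto
next
  case False
  define a b where "a = nrm x" and "b = nrm y"
  have pos: "0 < a * b" using False x y nrm_pos unfolding a_def b_def by auto
  define z where "z = complex_of_real b \<cdot>\<^sub>v x - complex_of_real a \<cdot>\<^sub>v y"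
  have z: "z \<in> carrier_vec n" using x y unfolding z_def by auto
  have "ip z z = b * b * ip x x - a * b * ip x y - a * b * ip y x + a * a * ip y y"
    unfolding z_def using x y by (simp add: ip_lin algebra_simps)
  then have "Re (ip z z) = Re (b * b * ip x x - a * b * ip x y - a * b * cnj (ip x y) + a * a * ip y y)"
    using ip_commute[OF x y] by simp
  also have "\<dots> = 2 * (a * b) * (a * b - Re (ip x y))"
    unfolding ip_self[OF x] ip_self[OF y] a_def[symmetric] b_def[symmetric]
    by (simp add: algebra_simps power2_eq_square)
  finally have "0 \<le> 2 * (a * b) * (a * b - Re (ip x y))"
    using ip_self_nonneg[OF z] by (simp add: less_eq_complex_def)
  then have "0 \<le> a * b - Re (ip x y)" using pos by (simp add: zero_le_mult_iff)
  then show ?thesis unfolding a_def b_def by simp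
qed

lemma B_invertible: "invertible_mat B"
proof -
  have "det B \<noteq> 0"
    unfolding det_0_iff_vec_prod_zero_field[OF B_carrier]
    using ip_pos unfolding ip_def by fastforce
  then have "B \<in> Units (ring_mat TYPE(complex) n ())"
    by (rule det_non_zero_imp_unit[OF B_carrier])
  then obtain C where "C \<in> carrier_mat n n" "C * B = 1\<^sub>m n" "B * C = 1\<^sub>m n"
    unfolding Units_def ring_mat_def by auto
  then show ?thesis unfolding invertible_mat_def inverts_mat_def by auto
qed

lemmas B_inv [simp] = mat_inv_carrier[OF B_carrier B_invertible]
  mat_inv_right[OF B_carrier B_invertible] mat_inv_left[OF B_carrier B_invertible]

lemma adjoint_B_carrier [simp]:
  assumes "C \<in> carrier_mat n n"
  shows "adjoint_B B C \<in> carrier_mat n n"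
  unfolding adjoint_B_def by (intro mult_carrier_mat[of _ n n] B_inv mat_adjoint_carrier B_carrier assms)

lemma ip_adjoint:
  assumes C: "C \<in> carrier_mat n n" and x: "x \<in> carrier_vec n" and y: "y \<in> carrier_vec n"
  shows "ip (C *\<^sub>v x) y = ip x (adjoint_B B C *\<^sub>v y)"
proof -
  let ?z = "mat_adjoint C *\<^sub>v (B *\<^sub>v y)"
  have CH: "mat_adjoint C \<in> carrier_mat n n" using C by (rule mat_adjoint_carrier)
  then have z: "?z \<in> carrier_vec n" using y by (intro mult_mat_vec_carrier) auto
  have "B *\<^sub>v (adjoint_B B C *\<^sub>v y) = B *\<^sub>v (mat_inv B *\<^sub>v ?z)"
    unfolding adjoint_B_def using CH y by simp
  also have "\<dots> = (B * mat_inv B) *\<^sub>v ?z"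
    using z by (subst assoc_mult_mat_vec[of _ n n _ n]) auto
  finally have eq: "B *\<^sub>v (adjoint_B B C *\<^sub>v y) = ?z" using z by simp
  have "ip (C *\<^sub>v x) y = (C *\<^sub>v x) \<bullet>c (B *\<^sub>v y)"
    using C x y by (intro ip_alt) auto
  also have "\<dots> = x \<bullet>c ?z"
    using C x y by (intro cscalar_prod_mat_adjoint) auto
  also have "\<dots> = ip x (adjoint_B B C *\<^sub>v y)"
    using C x y by (subst ip_alt) (auto simp: eq)
  finally show ?thesis .
qed

lemma mat_eq_on_vecI:
  fixes C D :: "complex mat"
  assumes C: "C \<in> carrier_mat n n" and D: "D \<in> carrier_mat n n"
    and eq: "\<And>y :: complex vec. y \<in> carrier_vec n \<Longrightarrow> C *\<^sub>v y = D *\<^sub>v y"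
  shows "C = D"
proof (rule eq_matI)
  fix i j assume ij: "i < dim_row D" "j < dim_col D"
  then have "(C *\<^sub>v unit_vec n j) $ i = (D *\<^sub>v unit_vec n j) $ i" using eq by simp
  then show "C $$ (i, j) = D $$ (i, j)" using C D ij by (simp add: scalar_prod_right_unit)
qed (use C D in auto)

text \<open>The algebraic rules for the \<open>B\<close>-adjoint below all come from this uniqueness statement:
  the adjoint is determined by moving the matrix across \<open>ip\<close>, because the form is definite.\<close>

lemma adjoint_B_unique:
  assumes C: "C \<in> carrier_mat n n" and D: "D \<in> carrier_mat n n"
    and eq: "\<And>x y. x \<in> carrier_vec n \<Longrightarrow> y \<in> carrier_vec n \<Longrightarrow> ip (C *\<^sub>v x) y = ip x (D *\<^sub>v y)"
  shows "adjoint_B B C = D"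
proof (rule mat_eq_on_vecI[OF adjoint_B_carrier[OF C] D])
  fix y :: "complex vec" assume y: "y \<in> carrier_vec n"
  let ?u = "adjoint_B B C *\<^sub>v y" and ?v = "D *\<^sub>v y"
  have u: "?u \<in> carrier_vec n" using C y by (intro mult_mat_vec_carrier[of _ n n]) auto
  have v: "?v \<in> carrier_vec n" using D y by auto
  have "ip (?u - ?v) (?u - ?v) = ip (?u - ?v) ?u - ip (?u - ?v) ?v"
    using u v by (intro ip_diff_right) auto
  also have "\<dots> = 0"
    using u v eq[of "?u - ?v" y] ip_adjoint[OF C, of "?u - ?v" y] y by simp
  finally have "?u - ?v = 0\<^sub>v n" using u v by (subst (asm) ip_self_eq_0_iff) auto
  then show "?u = ?v" by (rule vec_diff_zeroD[OF u v])
qed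

lemma adjoint_B_involution:
  assumes C: "C \<in> carrier_mat n n"
  shows "adjoint_B B (adjoint_B B C) = C"
proof (rule adjoint_B_unique[OF adjoint_B_carrier[OF C] C])
  fix x y :: "complex vec" assume x: "x \<in> carrier_vec n" and y: "y \<in> carrier_vec n"
  then have Cy: "C *\<^sub>v y \<in> carrier_vec n" "adjoint_B B C *\<^sub>v x \<in> carrier_vec n"
    using C by (auto intro!: mult_mat_vec_carrier[of _ n n])
  show "ip (adjoint_B B C *\<^sub>v x) y = ip x (C *\<^sub>v y)"
    using ip_adjoint[OF C y x] ip_commute[OF Cy(2) y] ip_commute[OF Cy(1) x] by simp
qed

lemma adjoint_B_mult:
  assumes C: "C \<in> carrier_mat n n" and D: "D \<in> carrier_mat n n"
  shows "adjoint_B B (C * D) = adjoint_B B D * adjoint_B B C"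
proof (rule adjoint_B_unique)
  fix x y :: "complex vec" assume x: "x \<in> carrier_vec n" and y: "y \<in> carrier_vec n"
  show "ip (C * D *\<^sub>v x) y = ip x (adjoint_B B D * adjoint_B B C *\<^sub>v y)"
    using x y C D by (simp add: ip_adjoint)
qed (use adjoint_B_carrier[OF C] adjoint_B_carrier[OF D] C D in auto)

lemma adjoint_B_one: "adjoint_B B (1\<^sub>m n) = 1\<^sub>m n"
  by (rule adjoint_B_unique) auto

lemma adjoint_B_minus:
  assumes C: "C \<in> carrier_mat n n" and D: "D \<in> carrier_mat n n"
  shows "adjoint_B B (C - D) = adjoint_B B C - adjoint_B B D"
proof (rule adjoint_B_unique)
  fix x y :: "complex vec" assume x: "x \<in> carrier_vec n" and y: "y \<in> carrier_vec n"
  show "ip ((C - D) *\<^sub>v x) y = ip x ((adjoint_B B C - adjoint_B B D) *\<^sub>v y)"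
    using x y C D adjoint_B_carrier[OF C] adjoint_B_carrier[OF D]
    by (simp add: minus_mult_distrib_mat_vec[of _ n n] ip_lin ip_adjoint)
qed (use adjoint_B_carrier[OF C] adjoint_B_carrier[OF D] C D in \<open>auto intro!: minus_carrier_mat\<close>)

lemma adjoint_B_pow:
  assumes C: "C \<in> carrier_mat n n"
  shows "adjoint_B B (C ^\<^sub>m k) = adjoint_B B C ^\<^sub>m k"
proof -
  have comm: "adjoint_B B C ^\<^sub>m Suc k = adjoint_B B C * adjoint_B B C ^\<^sub>m k" for k
  proof (induction k)
    case (Suc k)
    have "adjoint_B B C ^\<^sub>m Suc (Suc k) = (adjoint_B B C * adjoint_B B C ^\<^sub>m k) * adjoint_B B C"
      using Suc by simp
    also have "\<dots> = adjoint_B B C * adjoint_B B C ^\<^sub>m Suc k"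
      using adjoint_B_carrier[OF C] by (simp add: assoc_mult_mat[of _ n n _ n _ n])
    finally show ?case .
  qed (use adjoint_B_carrier[OF C] in simp)
  show ?thesis
  proof (induction k)
    case 0
    then show ?case using C carrier_matD(1)[OF adjoint_B_carrier[OF C]] by (simp add: adjoint_B_one)
  next
    case (Suc k)
    have "adjoint_B B (C ^\<^sub>m Suc k) = adjoint_B B C * adjoint_B B (C ^\<^sub>m k)"
      using C by (simp add: adjoint_B_mult)
    also have "\<dots> = adjoint_B B C ^\<^sub>m Suc k"
      using Suc comm by simp
    finally show ?case .
  qed
qed

end

section \<open>The largest eigenvalue of a self-adjoint matrix\<close>

text \<open>An annihilating polynomial of \<open>T\<close> enters the spectral argument only through its list of
  roots.  With the head of the list acting last, a vector killed by the whole list is mapped by the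
  tail to zero or to an eigenvector for the head.\<close>

primrec shifts :: "complex mat \<Rightarrow> complex list \<Rightarrow> complex vec \<Rightarrow> complex vec" where
  "shifts T [] x = x"
| "shifts T (a # as) x = T *\<^sub>v shifts T as x - a \<cdot>\<^sub>v shifts T as x"

lemma shifts_carrier [simp]:
  assumes "T \<in> carrier_mat n n" "x \<in> carrier_vec n"
  shows "shifts T as x \<in> carrier_vec n"
  using assms by (induction as) auto

text \<open>The factor belonging to the diagonal entry \<open>i\<close> maps vectors supported on the first
  \<open>i + 1\<close> coordinates to vectors supported on the first \<open>i\<close> coordinates, so the
  factors for all diagonal entries, applied from the last to the first, kill everything.\<close>

lemma shifts_upper_triangular:
  fixes U :: "complex mat"
  assumes U: "U \<in> carrier_mat n n" and tri: "upper_triangular U" and x: "x \<in> carrier_vec n"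
  shows "i \<le> n \<Longrightarrow> i \<le> j \<Longrightarrow> j < n \<Longrightarrow> shifts U (map (\<lambda>k. U $$ (k, k)) [i..<n]) x $ j = 0"
proof (induction i arbitrary: j rule: inc_induct)
  case base
  then show ?case by simp
next
  case (step i)
  define y where "y = shifts U (map (\<lambda>k. U $$ (k, k)) [Suc i..<n]) x"
  have y: "y \<in> carrier_vec n" unfolding y_def using U x by simp
  have y0: "y $ k = 0" if "Suc i \<le> k" "k < n" for k
    using step.IH that unfolding y_def by simp
  have "(U *\<^sub>v y) $ j = (\<Sum>k = 0..<n. U $$ (j, k) * y $ k)"
    using U y step.prems by (auto simp: scalar_prod_def intro!: sum.cong)
  also have "\<dots> = (\<Sum>k = 0..<n. if k = j then U $$ (j, j) * y $ j else 0)"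
  proof (rule sum.cong)
    fix k assume "k \<in> {0..<n}"
    then show "U $$ (j, k) * y $ k = (if k = j then U $$ (j, j) * y $ j else 0)"
      using y0[of k] tri U step.prems unfolding upper_triangular_def
      by (cases "k < j") auto
  qed simp
  also have "\<dots> = U $$ (j, j) * y $ j" using step.prems by simp
  finally have Uy: "(U *\<^sub>v y) $ j = U $$ (j, j) * y $ j" .
  have "shifts U (map (\<lambda>k. U $$ (k, k)) [i..<n]) x = U *\<^sub>v y - U $$ (i, i) \<cdot>\<^sub>v y"
    using step.hyps unfolding y_def by (simp add: upt_conv_Cons)
  also have "\<dots> $ j = U $$ (j, j) * y $ j - U $$ (i, i) * y $ j"
    using U y step.prems Uy by (simp del: index_mult_mat_vec)
  also have "\<dots> = 0" using y0[of j] step.prems by (cases "j = i") auto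
  finally show ?case .
qed

lemma shifts_conjugate:
  fixes U :: "complex mat"
  assumes U: "U \<in> carrier_mat n n" and P: "P \<in> carrier_mat n n"
    and T: "T \<in> carrier_mat n n" and TP: "T * P = P * U" and y: "y \<in> carrier_vec n"
  shows "shifts T as (P *\<^sub>v y) = P *\<^sub>v shifts U as y"
proof (induction as)
  case (Cons a as)
  have z: "shifts U as y \<in> carrier_vec n" using U y by simp
  have "T *\<^sub>v (P *\<^sub>v shifts U as y) = P *\<^sub>v (U *\<^sub>v shifts U as y)"
    using T P U z TP by (metis assoc_mult_mat_vec)
  then show ?case
    using Cons P U z mult_minus_distrib_mat_vec[OF P, of "U *\<^sub>v shifts U as y" "a \<cdot>\<^sub>v shifts U as y"]
      mult_mat_vec[OF P z, of a]
    by (simp add: mult_mat_vec_carrier[OF U])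
qed simp

text \<open>Every complex matrix is similar to an upper triangular one, and \<open>shifts\<close> is compatible
  with a change of basis.  This is the part of the Cayley--Hamilton theorem that the spectral
  argument needs.\<close>

lemma annihilating_shifts:
  assumes T: "T \<in> carrier_mat n n"
  obtains as where "\<And>x. x \<in> carrier_vec n \<Longrightarrow> shifts T as x = 0\<^sub>v n"
proof -
  obtain es where "char_poly T = (\<Prod>a\<leftarrow>es. [:- a, 1:])"
    using char_poly_factorized[OF T] by blast
  then obtain U where U: "U \<in> carrier_mat n n" "upper_triangular U" "similar_mat T U"
    using schur_decomposition_exists[OF T] by blast
  then obtain P Q where "similar_mat_wit T U P Q" unfolding similar_mat_def by blast
  note PQ = similar_mat_witD2[OF T this]
  have TP: "T * P = P * U"
  proof -
    have "T * P = P * U * (Q * P)"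
      unfolding PQ(3) by (rule assoc_mult_mat[OF mult_carrier_mat[OF PQ(6,5)] PQ(7,6)])
    then show ?thesis using right_mult_one_mat[OF mult_carrier_mat[OF PQ(6,5)]] PQ(2) by simp
  qed
  let ?as = "map (\<lambda>k. U $$ (k, k)) [0..<n]"
  have "shifts T ?as x = 0\<^sub>v n" if x: "x \<in> carrier_vec n" for x
  proof -
    define y where "y = Q *\<^sub>v x"
    have y: "y \<in> carrier_vec n" using PQ x unfolding y_def by simp
    have xy: "x = P *\<^sub>v y" unfolding y_def
      using PQ x assoc_mult_mat_vec[OF PQ(6,7) x] by simp
    have "shifts U ?as y = 0\<^sub>v n"
      using shifts_upper_triangular[OF U(1,2) y, of 0] carrier_vecD[OF shifts_carrier[OF U(1) y]]
      by (intro eq_vecI) auto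
    then show ?thesis
      using shifts_conjugate[OF U(1) PQ(6) T TP y] PQ(6) unfolding xy by auto
  qed
  then show ?thesis by (rule that)
qed

context hpd_form
begin

lemma orthogonal_BD:
  assumes "T \<in> carrier_mat n n" "orthogonal_B B T" "x \<in> carrier_vec n" "y \<in> carrier_vec n"
  shows "ip (T *\<^sub>v x) y = ip x (T *\<^sub>v y)"
  using ip_adjoint[OF assms(1,3,4)] assms(2) unfolding orthogonal_B_def by simp

lemma orthogonal_B_eigenvalue_real:
  assumes T: "T \<in> carrier_mat n n" and sa: "orthogonal_B B T"
    and v: "v \<in> carrier_vec n" "v \<noteq> 0\<^sub>v n" and ev: "T *\<^sub>v v = k \<cdot>\<^sub>v v"
  shows "cnj k = k"
proof -
  have "k * ip v v = cnj k * ip v v"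
    using orthogonal_BD[OF T sa v(1) v(1)] v unfolding ev by (simp add: ip_lin)
  then show ?thesis using v ip_self_eq_0_iff by auto
qed

lemma shifts_eigenvector:
  assumes y: "y \<in> carrier_vec n" and ev: "T *\<^sub>v y = a \<cdot>\<^sub>v y" and T: "T \<in> carrier_mat n n"
  shows "\<exists>k. shifts T as y = k \<cdot>\<^sub>v y"
proof (induction as)
  case Nil
  show ?case using y by (intro exI[of _ 1]) simp
next
  case (Cons b as)
  then obtain k where k: "shifts T as y = k \<cdot>\<^sub>v y" by blast
  have "T *\<^sub>v (k \<cdot>\<^sub>v y) = (k * a) \<cdot>\<^sub>v y"
    using mult_mat_vec[OF T y, of k] ev by (simp add: smult_smult_assoc)
  then have "shifts T (b # as) y = (k * a - b * k) \<cdot>\<^sub>v y"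
    using y by (intro eq_vecI) (auto simp: k smult_smult_assoc algebra_simps)
  then show ?case by blast
qed

lemma shifts_diff_smult:
  assumes T: "T \<in> carrier_mat n n" and x: "x \<in> carrier_vec n" and y: "y \<in> carrier_vec n"
  shows "shifts T as (x - c \<cdot>\<^sub>v y) = shifts T as x - c \<cdot>\<^sub>v shifts T as y"
proof (induction as)
  case (Cons a as)
  let ?u = "shifts T as x" and ?v = "shifts T as y"
  have u: "?u \<in> carrier_vec n" and v: "?v \<in> carrier_vec n" using T x y by auto
  have "T *\<^sub>v (?u - c \<cdot>\<^sub>v ?v) = T *\<^sub>v ?u - c \<cdot>\<^sub>v (T *\<^sub>v ?v)"
    using u v by (simp add: mult_minus_distrib_mat_vec[OF T] mult_mat_vec[OF T])
  then have "shifts T (a # as) (x - c \<cdot>\<^sub>v y)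
      = (T *\<^sub>v ?u - c \<cdot>\<^sub>v (T *\<^sub>v ?v)) - a \<cdot>\<^sub>v (?u - c \<cdot>\<^sub>v ?v)"
    by (simp add: Cons)
  also have "\<dots> = (T *\<^sub>v ?u - a \<cdot>\<^sub>v ?u) - c \<cdot>\<^sub>v (T *\<^sub>v ?v - a \<cdot>\<^sub>v ?v)"
  proof -
    have "(p - c \<cdot>\<^sub>v q) - a \<cdot>\<^sub>v (?u - c \<cdot>\<^sub>v ?v) = (p - a \<cdot>\<^sub>v ?u) - c \<cdot>\<^sub>v (q - a \<cdot>\<^sub>v ?v)"
      if "p \<in> carrier_vec n" "q \<in> carrier_vec n" for p q
      using u v that by (intro eq_vecI) (auto simp: right_diff_distrib)
    then show ?thesis using mult_vec_carrier[OF T u] mult_vec_carrier[OF T v] by blast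
  qed
  finally show ?case by simp
qed simp

text \<open>Self-adjointness makes the orthogonal complement of an eigenvector invariant under every factor
  \<open>T - b\<close>.\<close>

lemma ip_shifts_orthogonal:
  assumes T: "T \<in> carrier_mat n n" and sa: "orthogonal_B B T"
    and y: "y \<in> carrier_vec n" and ev: "T *\<^sub>v y = a \<cdot>\<^sub>v y"
    and x: "x \<in> carrier_vec n" and orth: "ip x y = 0"
  shows "ip (shifts T as x) y = 0"
proof (induction as)
  case (Cons b as)
  let ?z = "shifts T as x"
  have z: "?z \<in> carrier_vec n" using T x by simp
  have "ip (T *\<^sub>v ?z) y = 0"
    using orthogonal_BD[OF T sa z y] Cons y z by (simp add: ev ip_lin)
  then show ?case using Cons T y z by (simp add: ip_lin)
qed (use orth in simp)

text \<open>Induction on the annihilating list \<open>a # as\<close> of \<open>x\<close>.  The vector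
  \<open>y = shifts T as x\<close> is zero or an eigenvector for \<open>a\<close>.  In the second case split
  \<open>x = x' + c y\<close> with \<open>x'\<close> orthogonal to \<open>y\<close>.  Then
  \<open>shifts T as x'\<close> is a multiple of \<open>y\<close> and orthogonal to \<open>y\<close>, hence zero,
  so the induction hypothesis covers \<open>x'\<close>; the quadratic form and the square norm both split
  along \<open>x' + c y\<close>.\<close>

lemma rayleigh_le_shifts:
  assumes T: "T \<in> carrier_mat n n" and sa: "orthogonal_B B T"
    and bound: "\<And>k. k \<in> spectrum T \<Longrightarrow> Re k \<le> l"
  shows "x \<in> carrier_vec n \<Longrightarrow> shifts T as x = 0\<^sub>v n \<Longrightarrow> Re (ip (T *\<^sub>v x) x) \<le> l * (nrm x)\<^sup>2"
proof (induction as arbitrary: x)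
  case Nil
  then show ?case using T ip_zero_left ip_self[of x] orthogonal_BD[OF T sa, of x x] by simp
next
  case (Cons a as)
  define y where "y = shifts T as x"
  have x: "x \<in> carrier_vec n" by (rule Cons.prems)
  have y: "y \<in> carrier_vec n" unfolding y_def using T x by simp
  have ev: "T *\<^sub>v y = a \<cdot>\<^sub>v y"
    using vec_diff_zeroD[of "T *\<^sub>v y" n "a \<cdot>\<^sub>v y"] Cons.prems(2) T y unfolding y_def by simp
  show ?case
  proof (cases "y = 0\<^sub>v n")
    case True
    then show ?thesis using Cons.IH x unfolding y_def by blast
  next
    case False
    have "a \<in> spectrum T"
      unfolding spectrum_def eigenvalue_def eigenvector_def using False T y ev by auto
    then have al: "Re a \<le> l" by (rule bound)
    have yy: "ip y y \<noteq> 0" using ip_self_eq_0_iff[OF y] False by simp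
    define c where "c = ip x y / ip y y"
    define x' where "x' = x - c \<cdot>\<^sub>v y"
    have x': "x' \<in> carrier_vec n" unfolding x'_def using x y by simp
    have orth: "ip x' y = 0" unfolding x'_def c_def using x y yy by (simp add: ip_lin)
    have orth': "ip y x' = 0" using ip_commute[OF x' y] orth by simp
    obtain k where k: "shifts T as y = k \<cdot>\<^sub>v y" using shifts_eigenvector[OF y ev T] by blast
    have sx': "shifts T as x' = y - (c * k) \<cdot>\<^sub>v y"
      unfolding x'_def shifts_diff_smult[OF T x y] k y_def[symmetric] by (simp add: smult_smult_assoc)
    have "0 = ip (y - (c * k) \<cdot>\<^sub>v y) y"
      using ip_shifts_orthogonal[OF T sa y ev x' orth, of as] unfolding sx' by simp
    also have "\<dots> = (1 - c * k) * ip y y" using y by (simp add: ip_lin algebra_simps)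
    finally have "c * k = 1" using yy by simp
    then have "shifts T as x' = 0\<^sub>v n" unfolding sx' using y by simp
    then have IH: "Re (ip (T *\<^sub>v x') x') \<le> l * (nrm x')\<^sup>2" by (rule Cons.IH[OF x'])
    have xx': "x = x' + c \<cdot>\<^sub>v y" unfolding x'_def using x y by auto
    have cy: "c \<cdot>\<^sub>v y \<in> carrier_vec n" using y by simp
    have Tx: "T *\<^sub>v x = T *\<^sub>v x' + (c * a) \<cdot>\<^sub>v y"
      unfolding xx' mult_add_distrib_mat_vec[OF T x' cy] mult_mat_vec[OF T y] ev
      by (simp add: smult_smult_assoc)
    have Tx'y: "ip (T *\<^sub>v x') y = 0"
      using orthogonal_BD[OF T sa x' y] x' y orth by (simp add: ev ip_lin)
    have "ip (T *\<^sub>v x) x = ip (T *\<^sub>v x') x' + (c * cnj c) * (a * ip y y)"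
      unfolding Tx by (subst xx') (use x' y T Tx'y orth' in \<open>simp add: ip_lin algebra_simps\<close>)
    also have "\<dots> = ip (T *\<^sub>v x') x' + complex_of_real ((cmod c)\<^sup>2 * (nrm y)\<^sup>2) * a"
      unfolding ip_self[OF y] complex_norm_square[symmetric] by (simp add: ac_simps)
    finally have 1: "Re (ip (T *\<^sub>v x) x) = Re (ip (T *\<^sub>v x') x') + (cmod c)\<^sup>2 * (nrm y)\<^sup>2 * Re a"
      by simp
    have "ip x x = ip x' x' + (c * cnj c) * ip y y"
      unfolding xx' using x' y orth orth' by (simp add: ip_lin algebra_simps)
    also have "\<dots> = complex_of_real ((nrm x')\<^sup>2 + (cmod c)\<^sup>2 * (nrm y)\<^sup>2)"
      unfolding ip_self[OF y] ip_self[OF x'] complex_norm_square[symmetric] by simp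
    finally have 2: "(nrm x)\<^sup>2 = (nrm x')\<^sup>2 + (cmod c)\<^sup>2 * (nrm y)\<^sup>2"
      unfolding ip_self[OF x] by (simp only: of_real_eq_iff)
    have "(cmod c)\<^sup>2 * (nrm y)\<^sup>2 * Re a \<le> (cmod c)\<^sup>2 * (nrm y)\<^sup>2 * l"
      using al by (intro mult_left_mono) auto
    then show ?thesis using IH unfolding 1 2 by (simp add: algebra_simps)
  qed
qed

text \<open>The spectrum is finite, nonempty and real, so it has a largest element, attained at an
  eigenvector; an annihilating list of \<open>T\<close> extends the bound of \<open>rayleigh_le_shifts\<close> to
  all vectors.\<close>

lemma orthogonal_B_max_eigenvalue:
  assumes T: "T \<in> carrier_mat n n" and sa: "orthogonal_B B T" and n: "0 < n"
  obtains l v where "v \<in> carrier_vec n" "v \<noteq> 0\<^sub>v n" "T *\<^sub>v v = complex_of_real l \<cdot>\<^sub>v v"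
    "\<And>x. x \<in> carrier_vec n \<Longrightarrow> Re (ip (T *\<^sub>v x) x) \<le> l * (nrm x)\<^sup>2"
proof -
  have fin: "finite (Re ` spectrum T)" using card_finite_spectrum[OF T] by simp
  have ne: "Re ` spectrum T \<noteq> {}" using spectrum_non_empty[OF T n] by simp
  define l where "l = Max (Re ` spectrum T)"
  obtain k where k: "k \<in> spectrum T" "l = Re k" using Max_in[OF fin ne] unfolding l_def by blast
  then obtain v where v: "v \<in> carrier_vec n" "v \<noteq> 0\<^sub>v n" "T *\<^sub>v v = k \<cdot>\<^sub>v v"
    unfolding spectrum_def eigenvalue_def eigenvector_def using T by auto
  have "k = complex_of_real l"
    using orthogonal_B_eigenvalue_real[OF T sa v] k(2) by (simp add: complex_eq_iff)
  moreover have "Re (ip (T *\<^sub>v x) x) \<le> l * (nrm x)\<^sup>2" if "x \<in> carrier_vec n" for x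
  proof -
    obtain as where "\<And>x. x \<in> carrier_vec n \<Longrightarrow> shifts T as x = 0\<^sub>v n"
      using annihilating_shifts[OF T] by blast
    then show ?thesis
      using rayleigh_le_shifts[OF T sa, of l x as] fin that unfolding l_def by simp
  qed
  ultimately show ?thesis using that v by blast
qed

section \<open>The matrix norm of the inner product\<close>

lemma orthogonal_B_adjoint_mult:
  assumes "C \<in> carrier_mat n n"
  shows "orthogonal_B B (adjoint_B B C * C)"
  unfolding orthogonal_B_def
  using adjoint_B_mult[OF adjoint_B_carrier[OF assms] assms] adjoint_B_involution[OF assms] by metis

lemma ip_adjoint_mult:
  assumes C: "C \<in> carrier_mat n n" and x: "x \<in> carrier_vec n"
  shows "ip (adjoint_B B C * C *\<^sub>v x) x = complex_of_real ((nrm (C *\<^sub>v x))\<^sup>2)"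
proof -
  have Cx: "C *\<^sub>v x \<in> carrier_vec n" using C x by simp
  have "ip (adjoint_B B C * C *\<^sub>v x) x = ip (adjoint_B B C *\<^sub>v (C *\<^sub>v x)) x"
    using C x by simp
  also have "\<dots> = ip (C *\<^sub>v x) (C *\<^sub>v x)"
    using ip_adjoint[OF adjoint_B_carrier[OF C] Cx x] adjoint_B_involution[OF C] by simp
  also have "\<dots> = complex_of_real ((nrm (C *\<^sub>v x))\<^sup>2)" by (rule ip_self[OF Cx])
  finally show ?thesis .
qed

lemma mat_norm_B_eqI:
  assumes C: "C \<in> carrier_mat n n"
    and le: "\<And>x. x \<in> carrier_vec n \<Longrightarrow> nrm (C *\<^sub>v x) \<le> r * nrm x"
    and v: "v \<in> carrier_vec n" "v \<noteq> 0\<^sub>v n" "nrm (C *\<^sub>v v) = r * nrm v"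
  shows "mat_norm_B B C = r"
  unfolding mat_norm_B_def dim_B
proof (rule cSup_eq_maximum)
  show "r \<in> (\<lambda>x. nrm (C *\<^sub>v x) / nrm x) ` {x \<in> carrier_vec n. x \<noteq> 0\<^sub>v n}"
  proof (rule image_eqI[of _ _ v])
    show "r = nrm (C *\<^sub>v v) / nrm v" using v(3) nrm_pos[OF v(1,2)] by simp
  qed (use v in simp)
  fix s assume "s \<in> (\<lambda>x. nrm (C *\<^sub>v x) / nrm x) ` {x \<in> carrier_vec n. x \<noteq> 0\<^sub>v n}"
  then obtain x where x: "x \<in> carrier_vec n" "x \<noteq> 0\<^sub>v n" and s: "s = nrm (C *\<^sub>v x) / nrm x" by auto
  show "s \<le> r" unfolding s using le[OF x(1)] nrm_pos[OF x] by (simp add: pos_divide_le_eq)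
qed

text \<open>The square norm of \<open>C x\<close> is the quadratic form of \<open>C\<^sup>+ C\<close>.  So the supremum
  in the definition of the matrix norm is a maximum, taken at an eigenvector for the largest
  eigenvalue of \<open>C\<^sup>+ C\<close>, which is the square of the norm.\<close>

lemma mat_norm_B_attained:
  assumes C: "C \<in> carrier_mat n n" and n: "0 < n"
  obtains v where "v \<in> carrier_vec n" "v \<noteq> 0\<^sub>v n" "nrm (C *\<^sub>v v) = mat_norm_B B C * nrm v"
    "\<And>x. x \<in> carrier_vec n \<Longrightarrow> nrm (C *\<^sub>v x) \<le> mat_norm_B B C * nrm x"
    "adjoint_B B C * C *\<^sub>v v = complex_of_real ((mat_norm_B B C)\<^sup>2) \<cdot>\<^sub>v v"
proof -
  let ?T = "adjoint_B B C * C"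
  have T: "?T \<in> carrier_mat n n" using C by simp
  obtain l v where v: "v \<in> carrier_vec n" "v \<noteq> 0\<^sub>v n" and ev: "?T *\<^sub>v v = complex_of_real l \<cdot>\<^sub>v v"
    and le: "\<And>x. x \<in> carrier_vec n \<Longrightarrow> Re (ip (?T *\<^sub>v x) x) \<le> l * (nrm x)\<^sup>2"
    using orthogonal_B_max_eigenvalue[OF T orthogonal_B_adjoint_mult[OF C] n] by blast
  have le': "(nrm (C *\<^sub>v x))\<^sup>2 \<le> l * (nrm x)\<^sup>2" if "x \<in> carrier_vec n" for x
    using le[OF that] unfolding ip_adjoint_mult[OF C that] by simp
  have "complex_of_real ((nrm (C *\<^sub>v v))\<^sup>2) = complex_of_real (l * (nrm v)\<^sup>2)"
    using ip_adjoint_mult[OF C v(1)] v(1) unfolding ev by (simp add: ip_lin ip_self)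
  then have eq: "(nrm (C *\<^sub>v v))\<^sup>2 = l * (nrm v)\<^sup>2" by (simp only: of_real_eq_iff)
  have "0 \<le> l * (nrm v)\<^sup>2" unfolding eq[symmetric] by simp
  then have l: "0 \<le> l" using nrm_pos[OF v] by (simp add: zero_le_mult_iff)
  have le'': "nrm (C *\<^sub>v x) \<le> sqrt l * nrm x" if x: "x \<in> carrier_vec n" for x
  proof (rule power2_le_imp_le)
    show "(nrm (C *\<^sub>v x))\<^sup>2 \<le> (sqrt l * nrm x)\<^sup>2"
      using le'[OF x] l by (simp add: power_mult_distrib)
    show "0 \<le> sqrt l * nrm x" using l nrm_nonneg[OF x] by simp
  qed
  have eq'': "nrm (C *\<^sub>v v) = sqrt l * nrm v"
  proof (rule power2_eq_imp_eq)
    show "(nrm (C *\<^sub>v v))\<^sup>2 = (sqrt l * nrm v)\<^sup>2"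
      using eq l by (simp add: power_mult_distrib)
    show "0 \<le> nrm (C *\<^sub>v v)" using C v by simp
    show "0 \<le> sqrt l * nrm v" using l nrm_nonneg[OF v(1)] by simp
  qed
  have norm: "mat_norm_B B C = sqrt l" by (rule mat_norm_B_eqI[OF C le'' v eq''])
  show ?thesis
  proof (rule that[OF v])
    show "nrm (C *\<^sub>v v) = mat_norm_B B C * nrm v" unfolding norm by (rule eq'')
    show "nrm (C *\<^sub>v x) \<le> mat_norm_B B C * nrm x" if "x \<in> carrier_vec n" for x
      unfolding norm by (rule le''[OF that])
    show "?T *\<^sub>v v = complex_of_real ((mat_norm_B B C)\<^sup>2) \<cdot>\<^sub>v v" unfolding norm using ev l by simp
  qed
qed

end

section \<open>Powers of matrices\<close>

lemma commuting_pow_mult: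
  fixes C D :: "complex mat"
  assumes C: "C \<in> carrier_mat n n" and D: "D \<in> carrier_mat n n" and comm: "C * D = D * C"
  shows "C ^\<^sub>m k * D ^\<^sub>m k = (C * D) ^\<^sub>m k"
proof -
  interpret R: ring "ring_mat TYPE(complex) n ()" by (rule ring_mat)
  have CD: "C * D \<in> carrier_mat n n" using C D by (rule mult_carrier_mat)
  show ?thesis
    using R.pow_mult_distrib[of C D k] C D comm
    unfolding pow_mat_ring_pow[OF C, of _ "()"] pow_mat_ring_pow[OF D, of _ "()"]
      pow_mat_ring_pow[OF CD, of _ "()"]
    by (simp add: ring_mat_def)
qed

lemma pow_mat_Suc_vec:
  fixes C :: "complex mat"
  assumes "C \<in> carrier_mat n n" "x \<in> carrier_vec n"
  shows "C ^\<^sub>m Suc k *\<^sub>v x = C ^\<^sub>m k *\<^sub>v (C *\<^sub>v x)"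
  using assms assoc_mult_mat_vec[of "C ^\<^sub>m k" n n C n x] by simp

lemma pow_mat_injective:
  fixes C :: "complex mat"
  assumes C: "C \<in> carrier_mat n n" and inj: "\<And>x. x \<in> carrier_vec n \<Longrightarrow> C *\<^sub>v x = 0\<^sub>v n \<Longrightarrow> x = 0\<^sub>v n"
  shows "x \<in> carrier_vec n \<Longrightarrow> C ^\<^sub>m k *\<^sub>v x = 0\<^sub>v n \<Longrightarrow> x = 0\<^sub>v n"
proof (induction k arbitrary: x)
  case (Suc k)
  have Cx: "C *\<^sub>v x \<in> carrier_vec n" using C Suc.prems by simp
  have "C ^\<^sub>m k *\<^sub>v (C *\<^sub>v x) = 0\<^sub>v n"
    using Suc.prems pow_mat_Suc_vec[OF C Suc.prems(1)] by simp
  then show ?case using Suc.IH[OF Cx] inj Suc.prems(1) by blast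
qed (use C in simp)

section \<open>Norms of adjoints, products and normal matrices\<close>

context hpd_form
begin

lemma mult_assoc:
  fixes C D E :: "complex mat"
  shows "C \<in> carrier_mat n n \<Longrightarrow> D \<in> carrier_mat n n \<Longrightarrow> E \<in> carrier_mat n n
    \<Longrightarrow> C * D * E = C * (D * E)"
  by (rule assoc_mult_mat)

lemma mat_norm_B_nonneg:
  assumes C: "C \<in> carrier_mat n n" and n: "0 < n"
  shows "0 \<le> mat_norm_B B C"
proof -
  obtain v where v: "v \<in> carrier_vec n" "v \<noteq> 0\<^sub>v n" "nrm (C *\<^sub>v v) = mat_norm_B B C * nrm v"
    using mat_norm_B_attained[OF C n] by blast
  have "0 \<le> nrm (C *\<^sub>v v)" using nrm_nonneg[OF mult_vec_carrier[OF C v(1)]] .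
  then show ?thesis using nrm_pos[OF v(1,2)] unfolding v(3) by (simp add: zero_le_mult_iff)
qed

lemma nrm_mult_le:
  assumes C: "C \<in> carrier_mat n n" and x: "x \<in> carrier_vec n" and n: "0 < n"
  shows "nrm (C *\<^sub>v x) \<le> mat_norm_B B C * nrm x"
  using mat_norm_B_attained[OF C n] x by blast

lemma mat_norm_B_le:
  assumes C: "C \<in> carrier_mat n n" and n: "0 < n"
    and le: "\<And>x. x \<in> carrier_vec n \<Longrightarrow> nrm (C *\<^sub>v x) \<le> r * nrm x"
  shows "mat_norm_B B C \<le> r"
proof -
  obtain v where v: "v \<in> carrier_vec n" "v \<noteq> 0\<^sub>v n" "nrm (C *\<^sub>v v) = mat_norm_B B C * nrm v"
    using mat_norm_B_attained[OF C n] by blast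
  show ?thesis using le[OF v(1)] nrm_pos[OF v(1,2)] unfolding v(3) by simp
qed

text \<open>Only the norms of the images enter, so a normal matrix may be exchanged for its adjoint.\<close>

lemma mat_norm_B_cong:
  assumes "\<And>x. x \<in> carrier_vec n \<Longrightarrow> nrm (C *\<^sub>v x) = nrm (D *\<^sub>v x)"
  shows "mat_norm_B B C = mat_norm_B B D"
  unfolding mat_norm_B_def dim_B using assms by (intro SUP_cong) auto

text \<open>Cauchy--Schwarz for \<open>C\<^sup>+ C v\<close> and \<open>v\<close>, where \<open>v\<close> attains the norm of
  \<open>C\<close>.\<close>

lemma mat_norm_B_adjoint_mult_le:
  assumes C: "C \<in> carrier_mat n n" and n: "0 < n"
  shows "(mat_norm_B B C)\<^sup>2 \<le> mat_norm_B B (adjoint_B B C * C)"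
proof -
  let ?T = "adjoint_B B C * C"
  have T: "?T \<in> carrier_mat n n" using C by simp
  obtain v where v: "v \<in> carrier_vec n" "v \<noteq> 0\<^sub>v n" "nrm (C *\<^sub>v v) = mat_norm_B B C * nrm v"
    using mat_norm_B_attained[OF C n] by blast
  have "(mat_norm_B B C)\<^sup>2 * (nrm v)\<^sup>2 = (nrm (C *\<^sub>v v))\<^sup>2"
    unfolding v(3) by (simp add: power_mult_distrib)
  also have "\<dots> = Re (ip (?T *\<^sub>v v) v)" unfolding ip_adjoint_mult[OF C v(1)] by simp
  also have "\<dots> \<le> nrm (?T *\<^sub>v v) * nrm v" using Re_ip_le[OF mult_vec_carrier[OF T v(1)] v(1)] .
  also have "\<dots> \<le> mat_norm_B B ?T * nrm v * nrm v"
    using nrm_mult_le[OF T v(1) n] v(1) by (intro mult_right_mono) auto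
  finally show ?thesis using nrm_pos[OF v(1,2)] by (simp add: power2_eq_square)
qed

lemma mat_norm_B_mult_le:
  assumes C: "C \<in> carrier_mat n n" and D: "D \<in> carrier_mat n n" and n: "0 < n"
  shows "mat_norm_B B (C * D) \<le> mat_norm_B B C * mat_norm_B B D"
proof (rule mat_norm_B_le[OF mult_mat_closed[OF C D] n])
  fix x :: "complex vec" assume x: "x \<in> carrier_vec n"
  have "nrm (C * D *\<^sub>v x) \<le> mat_norm_B B C * nrm (D *\<^sub>v x)"
    using nrm_mult_le[OF C mult_vec_carrier[OF D x] n] C D x by simp
  also have "\<dots> \<le> mat_norm_B B C * (mat_norm_B B D * nrm x)"
    by (rule mult_left_mono[OF nrm_mult_le[OF D x n] mat_norm_B_nonneg[OF C n]])
  finally show "nrm (C * D *\<^sub>v x) \<le> mat_norm_B B C * mat_norm_B B D * nrm x"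
    by (simp add: mult.assoc)
qed

text \<open>From \<open>\<parallel>C\<parallel>\<^sup>2 \<le> \<parallel>C\<^sup>+ C\<parallel> \<le> \<parallel>C\<^sup>+\<parallel> \<parallel>C\<parallel>\<close> one gets
  \<open>\<parallel>C\<parallel> \<le> \<parallel>C\<^sup>+\<parallel>\<close>; the converse is the same inequality for \<open>C\<^sup>+\<close>.\<close>

lemma mat_norm_B_adjoint:
  assumes C: "C \<in> carrier_mat n n" and n: "0 < n"
  shows "mat_norm_B B (adjoint_B B C) = mat_norm_B B C"
proof -
  have le: "mat_norm_B B D \<le> mat_norm_B B (adjoint_B B D)" if D: "D \<in> carrier_mat n n" for D
  proof (cases "mat_norm_B B D = 0")
    case True
    then show ?thesis using mat_norm_B_nonneg[OF adjoint_B_carrier[OF D] n] by simp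
  next
    case False
    have "mat_norm_B B D * mat_norm_B B D \<le> mat_norm_B B (adjoint_B B D) * mat_norm_B B D"
      using mat_norm_B_adjoint_mult_le[OF D n] mat_norm_B_mult_le[OF adjoint_B_carrier[OF D] D n]
      by (simp add: power2_eq_square)
    then show ?thesis using mat_norm_B_nonneg[OF D n] False by simp
  qed
  show ?thesis
    using le[OF C] le[OF adjoint_B_carrier[OF C]] unfolding adjoint_B_involution[OF C] by simp
qed

lemma mat_norm_B_adjoint_mult:
  assumes C: "C \<in> carrier_mat n n" and n: "0 < n"
  shows "mat_norm_B B (adjoint_B B C * C) = (mat_norm_B B C)\<^sup>2"
  using mat_norm_B_adjoint_mult_le[OF C n] mat_norm_B_mult_le[OF adjoint_B_carrier[OF C] C n]
  unfolding mat_norm_B_adjoint[OF C n] by (simp add: power2_eq_square)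

lemma normal_B_nrm:
  assumes C: "C \<in> carrier_mat n n" and normal: "normal_B B C" and x: "x \<in> carrier_vec n"
  shows "nrm (adjoint_B B C *\<^sub>v x) = nrm (C *\<^sub>v x)"
proof -
  have "complex_of_real ((nrm (adjoint_B B C *\<^sub>v x))\<^sup>2) = ip (C * adjoint_B B C *\<^sub>v x) x"
    using ip_adjoint_mult[OF adjoint_B_carrier[OF C] x] unfolding adjoint_B_involution[OF C] by simp
  also have "\<dots> = complex_of_real ((nrm (C *\<^sub>v x))\<^sup>2)"
    using ip_adjoint_mult[OF C x] normal unfolding normal_B_def by simp
  finally have "(nrm (adjoint_B B C *\<^sub>v x))\<^sup>2 = (nrm (C *\<^sub>v x))\<^sup>2"
    by (simp only: of_real_eq_iff)
  then show ?thesis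
    using C x by (simp add: power2_eq_iff_nonneg)
qed

lemma normal_B_mat_norm_mult:
  assumes S: "S \<in> carrier_mat n n" and normal: "normal_B B S" and C: "C \<in> carrier_mat n n"
  shows "mat_norm_B B (S * C) = mat_norm_B B (adjoint_B B S * C)"
  using S C normal_B_nrm[OF S normal] by (intro mat_norm_B_cong) simp

text \<open>A left factor \<open>S\<close> may be replaced by \<open>S\<^sup>+\<close> without changing a norm.  Hence
  \<open>\<parallel>Q S\<parallel> = \<parallel>S\<^sup>+ Q\<parallel> = \<parallel>S Q\<parallel>\<close>, and
  \<open>\<parallel>S Q S\<parallel> = \<parallel>S\<^sup>+ Q S\<parallel> = \<parallel>(Q S)\<^sup>+ (Q S)\<parallel> = \<parallel>Q S\<parallel>\<^sup>2\<close>.  This avoids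
  the polar decomposition of \<open>S\<close>.\<close>

lemma normal_B_projection_norms:
  assumes S: "S \<in> carrier_mat n n" and normal: "normal_B B S" and n: "0 < n"
    and Q: "Q \<in> carrier_mat n n" and sa: "orthogonal_B B Q" and idem: "Q * Q = Q"
  shows "mat_norm_B B (Q * S) = mat_norm_B B (S * Q)"
    and "mat_norm_B B (S * Q * S) = (mat_norm_B B (Q * S))\<^sup>2"
proof -
  let ?S' = "adjoint_B B S"
  have S': "?S' \<in> carrier_mat n n" using S by simp
  have Qadj: "adjoint_B B Q = Q" using sa unfolding orthogonal_B_def .
  have adj: "adjoint_B B (Q * S) = ?S' * Q"
    using adjoint_B_mult[OF Q S] Qadj by simp
  have "mat_norm_B B (Q * S) = mat_norm_B B (?S' * Q)"
    using mat_norm_B_adjoint[OF mult_mat_closed[OF Q S] n] unfolding adj by simp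
  then show "mat_norm_B B (Q * S) = mat_norm_B B (S * Q)"
    using normal_B_mat_norm_mult[OF S normal Q] by simp
  have "?S' * (Q * S) = ?S' * Q * (Q * S)"
    using S S' Q idem by (metis mult_assoc mult_mat_closed)
  then have "mat_norm_B B (?S' * (Q * S)) = (mat_norm_B B (Q * S))\<^sup>2"
    using mat_norm_B_adjoint_mult[OF mult_mat_closed[OF Q S] n] unfolding adj by simp
  then show "mat_norm_B B (S * Q * S) = (mat_norm_B B (Q * S))\<^sup>2"
    using normal_B_mat_norm_mult[OF S normal mult_mat_closed[OF Q S]] mult_assoc[OF S Q S] by simp
qed

lemma one_minus_adjoint_mult_vec:
  assumes S: "S \<in> carrier_mat n n" and x: "x \<in> carrier_vec n"
  shows "(1\<^sub>m n - adjoint_B B S * S) *\<^sub>v x = x - adjoint_B B S *\<^sub>v (S *\<^sub>v x)"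
  using S x by (simp add: minus_mult_distrib_mat_vec[of _ n n])

lemma ip_one_minus_adjoint_mult:
  assumes S: "S \<in> carrier_mat n n" and x: "x \<in> carrier_vec n"
  shows "ip ((1\<^sub>m n - adjoint_B B S * S) *\<^sub>v x) x
    = complex_of_real ((nrm x)\<^sup>2 - (nrm (S *\<^sub>v x))\<^sup>2)"
proof -
  have "ip ((1\<^sub>m n - adjoint_B B S * S) *\<^sub>v x) x = ip x x - ip (adjoint_B B S * S *\<^sub>v x) x"
    using S x by (simp add: minus_mult_distrib_mat_vec[of _ n n] ip_lin)
  then show ?thesis unfolding ip_adjoint_mult[OF S x] ip_self[OF x] by simp
qed

section \<open>Matrices derived from the smoother\<close>

lemma mat_adjoint_inv_B: "mat_adjoint (mat_inv B) = mat_inv B"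
proof -
  have "mat_adjoint (mat_inv B) * B = mat_adjoint (B * mat_inv B)"
    using mat_adjoint_mult[OF B_carrier B_inv(1)] B_adjoint by simp
  also have "\<dots> = 1\<^sub>m n" by (auto intro!: eq_matI)
  finally have "mat_adjoint (mat_inv B) * B * mat_inv B = mat_inv B" by simp
  then show ?thesis
    using mult_assoc[OF mat_adjoint_carrier[OF B_inv(1)] B_carrier B_inv(1)]
      mat_adjoint_carrier[OF B_inv(1)] by simp
qed

text \<open>Positivity of the Hermitian form of \<open>Y * mat_inv B\<close> at \<open>x = B z\<close> is positivity of the
  \<open>B\<close>-form of \<open>Y\<close> at \<open>z\<close>.\<close>

lemma hpd_mult_inv_B:
  assumes Y: "Y \<in> carrier_mat n n" and sa: "orthogonal_B B Y"
    and pos: "\<And>z. z \<in> carrier_vec n \<Longrightarrow> z \<noteq> 0\<^sub>v n \<Longrightarrow> 0 < ip (Y *\<^sub>v z) z"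
  shows "hpd (Y * mat_inv B)"
proof -
  have X: "Y * mat_inv B \<in> carrier_mat n n" using Y by simp
  have YH: "mat_adjoint Y \<in> carrier_mat n n" using Y by simp
  have "mat_adjoint (Y * mat_inv B) = mat_inv B * mat_adjoint Y"
    using mat_adjoint_mult[OF Y B_inv(1)] mat_adjoint_inv_B by simp
  also have "\<dots> = mat_inv B * mat_adjoint Y * (B * mat_inv B)"
    using mult_mat_closed[OF B_inv(1) YH] by simp
  also have "\<dots> = adjoint_B B Y * mat_inv B"
    unfolding adjoint_B_def
    using mult_assoc[OF mult_mat_closed[OF B_inv(1) YH] B_carrier B_inv(1)] by simp
  finally have adj: "mat_adjoint (Y * mat_inv B) = Y * mat_inv B"
    using sa unfolding orthogonal_B_def by simp
  have "0 < (Y * mat_inv B *\<^sub>v x) \<bullet>c x" if x: "x \<in> carrier_vec n" "x \<noteq> 0\<^sub>v n" for x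
  proof -
    define z where "z = mat_inv B *\<^sub>v x"
    have z: "z \<in> carrier_vec n" unfolding z_def using x by simp
    have xz: "x = B *\<^sub>v z" unfolding z_def
      using mult_mult_vec[OF B_carrier B_inv(1) x(1)] x by simp
    have z0: "z \<noteq> 0\<^sub>v n" using x(2) unfolding xz by auto
    have "(Y * mat_inv B *\<^sub>v x) \<bullet>c x = (Y *\<^sub>v z) \<bullet>c (B *\<^sub>v z)"
      using mult_mult_vec[OF Y B_inv(1) x(1)] unfolding z_def[symmetric] xz[symmetric] by simp
    also have "\<dots> = ip (Y *\<^sub>v z) z"
      using ip_alt[OF mult_vec_carrier[OF Y z] z] by simp
    finally show ?thesis using pos[OF z z0] by simp
  qed
  then show ?thesis
    unfolding hpd_def using adj carrier_matD[OF X] by simp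
qed

lemma normal_B_pow:
  assumes G: "G \<in> carrier_mat n n" and normal: "normal_B B G"
  shows "normal_B B (G ^\<^sub>m k)"
    and "adjoint_B B (G ^\<^sub>m k) * G ^\<^sub>m k = (G * adjoint_B B G) ^\<^sub>m k"
proof -
  have comm: "G * adjoint_B B G = adjoint_B B G * G" using normal unfolding normal_B_def .
  note pow = commuting_pow_mult[OF G adjoint_B_carrier[OF G] comm, of k]
    commuting_pow_mult[OF adjoint_B_carrier[OF G] G comm[symmetric], of k]
  show "adjoint_B B (G ^\<^sub>m k) * G ^\<^sub>m k = (G * adjoint_B B G) ^\<^sub>m k"
    unfolding adjoint_B_pow[OF G] pow(2) comm ..
  show "normal_B B (G ^\<^sub>m k)"
    unfolding normal_B_def adjoint_B_pow[OF G] pow comm ..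
qed

text \<open>The exponent \<open>Suc k\<close> is essential: the zeroth power is the identity, which does not
  contract strictly.\<close>

lemma strict_contraction_pow:
  assumes G: "G \<in> carrier_mat n n"
    and c: "\<And>x. x \<in> carrier_vec n \<Longrightarrow> x \<noteq> 0\<^sub>v n \<Longrightarrow> nrm (G *\<^sub>v x) < nrm x"
  shows "x \<in> carrier_vec n \<Longrightarrow> x \<noteq> 0\<^sub>v n \<Longrightarrow> nrm (G ^\<^sub>m Suc k *\<^sub>v x) < nrm x"
proof (induction k arbitrary: x)
  case 0
  then show ?case using c[of x] G by simp
next
  case (Suc k)
  let ?y = "G *\<^sub>v x"
  have y: "?y \<in> carrier_vec n" using G Suc.prems by simp
  have "nrm (G ^\<^sub>m Suc k *\<^sub>v ?y) \<le> nrm ?y"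
  proof (cases "?y = 0\<^sub>v n")
    case True
    have "G ^\<^sub>m Suc k *\<^sub>v 0\<^sub>v n = 0\<^sub>v n"
      by (rule square_mat_simps(4)[OF pow_carrier_mat[OF G]])
    then show ?thesis unfolding True by simp
  qed (use Suc.IH[OF y] in simp)
  also have "\<dots> < nrm x" by (rule c[OF Suc.prems])
  finally show ?case using pow_mat_Suc_vec[OF G Suc.prems(1), of "Suc k"] by simp
qed

lemma one_minus_mult_one_minus:
  fixes C D :: "complex mat"
  assumes C: "C \<in> carrier_mat n n" and D: "D \<in> carrier_mat n n"
  shows "(1\<^sub>m n - C) * (1\<^sub>m n - D) = 1\<^sub>m n - (C + D - C * D)"
proof -
  have CD: "C * D \<in> carrier_mat n n" using C D by simp
  have "(1\<^sub>m n - C) * (1\<^sub>m n - D) = (1\<^sub>m n - C) * 1\<^sub>m n - (1\<^sub>m n - C) * D"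
    using C D by (intro mult_minus_distrib_mat[of _ n n]) simp_all
  also have "\<dots> = (1\<^sub>m n - C) - (1\<^sub>m n * D - C * D)"
    using C D minus_mult_distrib_mat[OF one_carrier_mat C D] by simp
  also have "\<dots> = 1\<^sub>m n - (C + D - C * D)"
    using C D CD by (intro eq_matI) auto
  finally show ?thesis .
qed

text \<open>Writing \<open>N\<close> for \<open>mat_inv M * A\<close>, the three terms of \<open>Mhat_inv\<close> times
  \<open>B\<close> are \<open>N\<close>, \<open>N\<^sup>+\<close> and \<open>N N\<^sup>+\<close>.\<close>

lemma one_minus_Mhat_inv:
  assumes A: "A \<in> carrier_mat n n" and Mi: "mat_inv M \<in> carrier_mat n n"
  shows "1\<^sub>m n - Mhat_inv A M B * B
    = (1\<^sub>m n - mat_inv M * A) * adjoint_B B (1\<^sub>m n - mat_inv M * A)"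
proof -
  define N where "N = mat_inv M * A"
  have N: "N \<in> carrier_mat n n" unfolding N_def using A Mi by simp
  have AH: "mat_adjoint A \<in> carrier_mat n n" and MH: "mat_adjoint (mat_inv M) \<in> carrier_mat n n"
    using A Mi by auto
  let ?Z = "mat_inv B * mat_adjoint A * mat_adjoint (mat_inv M)"
  have Z: "?Z \<in> carrier_mat n n" using AH MH by simp
  have adj: "adjoint_B B N = ?Z * B"
    unfolding adjoint_B_def N_def mat_adjoint_mult[OF Mi A]
    using mult_assoc[OF B_inv(1) AH MH] by simp
  have "Mhat_inv A M B = N * mat_inv B + ?Z - N * ?Z"
    unfolding Mhat_inv_def N_def[symmetric]
    using N AH MH by (simp add: mult_assoc)
  then have "Mhat_inv A M B * B = N * mat_inv B * B + ?Z * B - N * ?Z * B"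
    using N Z minus_mult_distrib_mat[OF add_carrier_mat[OF Z, of "N * mat_inv B"]
        mult_mat_closed[OF N Z] B_carrier]
      add_mult_distrib_mat[OF mult_mat_closed[OF N B_inv(1)] Z B_carrier] by simp
  also have "\<dots> = N + adjoint_B B N - N * adjoint_B B N"
    unfolding adj using N Z mult_assoc[OF N B_inv(1) B_carrier] mult_assoc[OF N Z B_carrier] by simp
  finally have "1\<^sub>m n - Mhat_inv A M B * B = (1\<^sub>m n - N) * (1\<^sub>m n - adjoint_B B N)"
    using one_minus_mult_one_minus[OF N adjoint_B_carrier[OF N]] by simp
  then show ?thesis
    unfolding N_def[symmetric] adjoint_B_minus[OF one_carrier_mat N] adjoint_B_one .
qed

end

section \<open>A positive definite matrix compressed by a projection\<close>

text \<open>The matrix \<open>1 - S\<^sup>+ S\<close> is positive definite in the \<open>B\<close>-inner product, and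
  multiplying it by the \<open>B\<close>-orthogonal projection \<open>Q\<close> gives a matrix with the same
  nonzero eigenvalues as its self-adjoint compression \<open>Q (1 - S\<^sup>+ S) Q\<close>.\<close>

locale compressed_contraction = hpd_form +
  fixes S Q :: "complex mat"
  assumes n: "0 < n"
    and S: "S \<in> carrier_mat n n"
    and contraction: "\<And>x. x \<in> carrier_vec n \<Longrightarrow> x \<noteq> 0\<^sub>v n \<Longrightarrow> vec_norm_B B (S *\<^sub>v x) < vec_norm_B B x"
    and inj: "\<And>x. x \<in> carrier_vec n \<Longrightarrow> S *\<^sub>v x = 0\<^sub>v n \<Longrightarrow> x = 0\<^sub>v n"
    and Q: "Q \<in> carrier_mat n n" and sa: "orthogonal_B B Q" and idem: "Q * Q = Q"
begin

abbreviation compressed :: "complex mat" where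
  "compressed \<equiv> (1\<^sub>m n - adjoint_B B S * S) * Q"

lemma Q_idem_vec: "x \<in> carrier_vec n \<Longrightarrow> Q *\<^sub>v (Q *\<^sub>v x) = Q *\<^sub>v x"
  using mult_mult_vec[OF Q Q, of x] idem by simp

lemma compressed_vec:
  assumes x: "x \<in> carrier_vec n"
  shows "compressed *\<^sub>v x = (1\<^sub>m n - adjoint_B B S * S) *\<^sub>v (Q *\<^sub>v x)"
  using S Q x by (intro mult_mult_vec) simp

lemma compressed_carrier: "compressed \<in> carrier_mat n n"
  using S Q by simp

text \<open>If \<open>w\<close> is an eigenvector for \<open>k \<noteq> 0\<close>, then \<open>u = Q w\<close> is nonzero, lies in
  the range of \<open>Q\<close>, and satisfies \<open>k \<parallel>u\<parallel>\<^sup>2 = \<parallel>u\<parallel>\<^sup>2 - \<parallel>S u\<parallel>\<^sup>2\<close>.  The bounds on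
  \<open>k\<close> are those on \<open>\<parallel>S u\<parallel> / \<parallel>u\<parallel>\<close>.\<close>

lemma compressed_nonzero_eigenvalue:
  assumes k: "k \<in> spectrum compressed" "k \<noteq> 0"
  shows "\<exists>r. k = complex_of_real r \<and> 1 - (mat_norm_B B (S * Q))\<^sup>2 \<le> r \<and> r < 1"
proof -
  let ?Y = "1\<^sub>m n - adjoint_B B S * S"
  have Y: "?Y \<in> carrier_mat n n" using S by simp
  obtain w where w: "w \<in> carrier_vec n" "w \<noteq> 0\<^sub>v n" "compressed *\<^sub>v w = k \<cdot>\<^sub>v w"
    using k compressed_carrier unfolding spectrum_def eigenvalue_def eigenvector_def by auto
  define u where "u = Q *\<^sub>v w"
  have u: "u \<in> carrier_vec n" unfolding u_def using Q w by simp
  have Yu: "?Y *\<^sub>v u = k \<cdot>\<^sub>v w" unfolding u_def using compressed_vec[OF w(1)] w(3) by simp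
  have Qu: "Q *\<^sub>v u = u" unfolding u_def by (rule Q_idem_vec[OF w(1)])
  have u0: "u \<noteq> 0\<^sub>v n"
  proof
    assume "u = 0\<^sub>v n"
    then have "k \<cdot>\<^sub>v w = 0\<^sub>v n" using Yu Y by auto
    then have "(1 / k) \<cdot>\<^sub>v (k \<cdot>\<^sub>v w) = 0\<^sub>v n" by (auto intro!: eq_vecI)
    then show False using w(2) k(2) by (simp add: smult_smult_assoc)
  qed
  have "k * ip u u = ip (Q *\<^sub>v (k \<cdot>\<^sub>v w)) u"
    unfolding mult_mat_vec[OF Q w(1)] u_def[symmetric] using u by (simp add: ip_lin)
  also have "\<dots> = ip (?Y *\<^sub>v u) u"
    unfolding Yu[symmetric] using orthogonal_BD[OF Q sa mult_vec_carrier[OF Y u] u] Qu by simp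
  finally have eq: "k * complex_of_real ((nrm u)\<^sup>2) = complex_of_real ((nrm u)\<^sup>2 - (nrm (S *\<^sub>v u))\<^sup>2)"
    unfolding ip_one_minus_adjoint_mult[OF S u] ip_self[OF u] .
  have pos: "0 < (nrm u)\<^sup>2" using nrm_pos[OF u u0] by simp
  define r where "r = ((nrm u)\<^sup>2 - (nrm (S *\<^sub>v u))\<^sup>2) / (nrm u)\<^sup>2"
  have "k = complex_of_real r"
    unfolding r_def of_real_divide using eq pos by (simp add: eq_divide_eq)
  moreover have "r < 1"
  proof -
    have "0 < nrm (S *\<^sub>v u)" using nrm_pos[of "S *\<^sub>v u"] inj[OF u] u0 S u by auto
    then show ?thesis unfolding r_def using pos by (simp add: divide_less_eq)
  qed
  moreover have "1 - (mat_norm_B B (S * Q))\<^sup>2 \<le> r"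
  proof -
    have "nrm (S *\<^sub>v u) \<le> mat_norm_B B (S * Q) * nrm u"
      using nrm_mult_le[OF mult_mat_closed[OF S Q] u n] S Q u Qu by simp
    then have "(nrm (S *\<^sub>v u))\<^sup>2 \<le> (mat_norm_B B (S * Q))\<^sup>2 * (nrm u)\<^sup>2"
      using power_mono[OF _ nrm_nonneg[OF mult_vec_carrier[OF S u]], of _ 2]
      unfolding power_mult_distrib[symmetric] by blast
    then show ?thesis unfolding r_def using pos by (simp add: le_divide_eq algebra_simps)
  qed
  ultimately show ?thesis by blast
qed

text \<open>Let \<open>v\<close> be an eigenvector of \<open>(S Q)\<^sup>+ (S Q) = Q S\<^sup>+ S Q\<close> at which the norm
  \<open>s\<close> of \<open>S Q\<close> is attained.  Since \<open>s > 0\<close>, it lies in the range of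
  \<open>Q\<close>, so \<open>Q (1 - S\<^sup>+ S) v = (1 - s\<^sup>2) v\<close>.  Applying \<open>1 - S\<^sup>+ S\<close> once more
  shows that \<open>(1 - S\<^sup>+ S) v\<close> is the required eigenvector.\<close>

lemma compressed_smallest_eigenvalue:
  assumes Q0: "Q \<noteq> 0\<^sub>m n n"
  shows "0 < mat_norm_B B (S * Q)" "mat_norm_B B (S * Q) < 1"
    and "complex_of_real (1 - (mat_norm_B B (S * Q))\<^sup>2) \<in> spectrum compressed"
proof -
  let ?Y = "1\<^sub>m n - adjoint_B B S * S"
  define s where "s = mat_norm_B B (S * Q)"
  have Y: "?Y \<in> carrier_mat n n" using S by simp
  have SQ: "S * Q \<in> carrier_mat n n" using S Q by simp
  have S': "adjoint_B B S \<in> carrier_mat n n" using S by simp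
  have adj: "adjoint_B B (S * Q) = Q * adjoint_B B S"
    using adjoint_B_mult[OF S Q] sa unfolding orthogonal_B_def by simp
  obtain v where v: "v \<in> carrier_vec n" "v \<noteq> 0\<^sub>v n"
    and att: "nrm (S * Q *\<^sub>v v) = s * nrm v"
    and ev: "adjoint_B B (S * Q) * (S * Q) *\<^sub>v v = complex_of_real (s\<^sup>2) \<cdot>\<^sub>v v"
    using mat_norm_B_attained[OF SQ n] unfolding s_def by blast
  have "s \<noteq> 0"
  proof
    assume s0: "s = 0"
    have "Q = 0\<^sub>m n n"
    proof (rule mat_eq_on_vecI[OF Q])
      fix y :: "complex vec" assume y: "y \<in> carrier_vec n"
      have "nrm (S *\<^sub>v (Q *\<^sub>v y)) \<le> 0"
        using nrm_mult_le[OF SQ y n] s0 S Q y unfolding s_def by simp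
      then have "S *\<^sub>v (Q *\<^sub>v y) = 0\<^sub>v n"
        using nrm_pos[of "S *\<^sub>v (Q *\<^sub>v y)"] S Q y by fastforce
      then show "Q *\<^sub>v y = 0\<^sub>m n n *\<^sub>v y" using inj[of "Q *\<^sub>v y"] Q y by simp
    qed simp
    then show False using Q0 by blast
  qed
  then have s: "0 < s" using mat_norm_B_nonneg[OF SQ n] unfolding s_def by simp
  have ev': "Q *\<^sub>v (adjoint_B B S *\<^sub>v (S *\<^sub>v (Q *\<^sub>v v))) = complex_of_real (s\<^sup>2) \<cdot>\<^sub>v v"
    using ev S S' Q v unfolding adj by simp
  \<comment> \<open>The matrix of the eigenvalue equation starts with \<open>Q\<close>, so \<open>Q\<close> fixes its image.\<close>
  have Qv: "Q *\<^sub>v v = v"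
  proof -
    have "Q *\<^sub>v (complex_of_real (s\<^sup>2) \<cdot>\<^sub>v v) = complex_of_real (s\<^sup>2) \<cdot>\<^sub>v v"
      unfolding ev'[symmetric] using S Q v by (intro Q_idem_vec) simp
    then have "complex_of_real (s\<^sup>2) \<cdot>\<^sub>v (Q *\<^sub>v v) = complex_of_real (s\<^sup>2) \<cdot>\<^sub>v v"
      unfolding mult_mat_vec[OF Q v(1)] .
    then have "complex_of_real (1 / s\<^sup>2) \<cdot>\<^sub>v (complex_of_real (s\<^sup>2) \<cdot>\<^sub>v (Q *\<^sub>v v))
      = complex_of_real (1 / s\<^sup>2) \<cdot>\<^sub>v (complex_of_real (s\<^sup>2) \<cdot>\<^sub>v v)" by simp
    then show ?thesis using s by (simp add: smult_smult_assoc)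
  qed
  have "s * nrm v < nrm v"
    using contraction[OF v] att S Q v Qv by simp
  then have s1: "s < 1" using nrm_pos[OF v] by simp
  have s2: "s\<^sup>2 < 1" using s s1 by (simp add: power_less_one_iff)
  define w where "w = ?Y *\<^sub>v v"
  have w: "w \<in> carrier_vec n" unfolding w_def using mult_vec_carrier[OF Y v(1)] .
  have Qw: "Q *\<^sub>v w = complex_of_real (1 - s\<^sup>2) \<cdot>\<^sub>v v"
  proof -
    have "Q *\<^sub>v w = Q *\<^sub>v v - Q *\<^sub>v (adjoint_B B S *\<^sub>v (S *\<^sub>v v))"
      unfolding w_def one_minus_adjoint_mult_vec[OF S v(1)]
      using S Q v by (intro mult_minus_distrib_mat_vec[of _ n n]) auto
    also have "\<dots> = v - complex_of_real (s\<^sup>2) \<cdot>\<^sub>v v"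
      using ev' unfolding Qv by simp
    also have "\<dots> = complex_of_real (1 - s\<^sup>2) \<cdot>\<^sub>v v"
      using v by (intro eq_vecI) (auto simp: algebra_simps)
    finally show ?thesis .
  qed
  \<comment> \<open>Otherwise \<open>Q w = (1 - s\<^sup>2) v\<close> would vanish, although \<open>s < 1\<close>.\<close>
  have w0: "w \<noteq> 0\<^sub>v n"
  proof
    assume "w = 0\<^sub>v n"
    then have 0: "complex_of_real (1 - s\<^sup>2) \<cdot>\<^sub>v v = 0\<^sub>v n" using Qw Q by auto
    have "ip (complex_of_real (1 - s\<^sup>2) \<cdot>\<^sub>v v) v = complex_of_real (1 - s\<^sup>2) * ip v v"
      using v by (intro ip_smult_left)
    then have "complex_of_real (1 - s\<^sup>2) * ip v v = 0" unfolding 0 using v by simp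
    then have "complex_of_real (1 - s\<^sup>2) = 0" using v ip_self_eq_0_iff by simp
    then show False using s2 by (simp only: of_real_eq_0_iff)
  qed
  have "compressed *\<^sub>v w = complex_of_real (1 - s\<^sup>2) \<cdot>\<^sub>v w"
    unfolding compressed_vec[OF w] Qw mult_mat_vec[OF Y v(1)] w_def[symmetric] ..
  then have "complex_of_real (1 - s\<^sup>2) \<in> spectrum compressed"
    unfolding spectrum_def eigenvalue_def eigenvector_def carrier_matD(1)[OF compressed_carrier]
    using w w0 by blast
  then show "0 < mat_norm_B B (S * Q)" "mat_norm_B B (S * Q) < 1"
    "complex_of_real (1 - (mat_norm_B B (S * Q))\<^sup>2) \<in> spectrum compressed"
    using s s1 unfolding s_def by auto
qed

text \<open>The eigenvalue of the previous lemma is positive because \<open>S Q\<close> has norm below one, and it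
  is a lower bound for every nonzero eigenvalue.\<close>

lemma lambda_min_pos_compressed:
  assumes Q0: "Q \<noteq> 0\<^sub>m n n"
  shows "lambda_min_pos compressed = 1 - (mat_norm_B B (S * Q))\<^sup>2"
proof -
  note core = compressed_smallest_eigenvalue[OF Q0]
  have lt: "(mat_norm_B B (S * Q))\<^sup>2 < 1" using core by (simp add: power_less_one_iff)
  show ?thesis
    unfolding lambda_min_pos_def
  proof (rule Min_eqI)
    have "{r. 0 < r \<and> complex_of_real r \<in> spectrum compressed} \<subseteq> Re ` spectrum compressed"
      by (auto intro!: image_eqI[of _ Re "complex_of_real _"])
    then show "finite {r. 0 < r \<and> complex_of_real r \<in> spectrum compressed}"
      using card_finite_spectrum[OF compressed_carrier] finite_subset by blast
    show "1 - (mat_norm_B B (S * Q))\<^sup>2 \<in> {r. 0 < r \<and> complex_of_real r \<in> spectrum compressed}"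
      using core(3) lt by simp
    fix r assume "r \<in> {r. 0 < r \<and> complex_of_real r \<in> spectrum compressed}"
    then have r: "complex_of_real r \<in> spectrum compressed" "complex_of_real r \<noteq> 0" by auto
    then obtain r' where "complex_of_real r = complex_of_real r'" "1 - (mat_norm_B B (S * Q))\<^sup>2 \<le> r'"
      using compressed_nonzero_eigenvalue by blast
    then show "1 - (mat_norm_B B (S * Q))\<^sup>2 \<le> r" by (simp only: of_real_eq_iff)
  qed
qed


end

section \<open>The two-grid error propagator\<close>

lemma Pi_proj_idem:
  assumes A: "A \<in> carrier_mat n n" and P: "P \<in> carrier_mat n m" and R: "R \<in> carrier_mat n m"
    and inv: "invertible_mat (mat_adjoint R * A * P)"
  shows "Pi_proj A P R \<in> carrier_mat n n" "Pi_proj A P R * Pi_proj A P R = Pi_proj A P R"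
proof -
  let ?L = "mat_adjoint R * A"
  have L: "?L \<in> carrier_mat m n" using A R by (auto intro!: mult_carrier_mat)
  have LP: "?L * P \<in> carrier_mat m m" using L P by simp
  note W = mat_inv[OF LP inv]
  let ?W = "mat_inv (?L * P)"
  have WL: "?W * ?L \<in> carrier_mat m n" using W(1) L by simp
  have Pi: "Pi_proj A P R = P * (?W * ?L)"
    unfolding Pi_proj_def
    using assoc_mult_mat[OF mult_carrier_mat[OF P W(1)] mat_adjoint_carrier[OF R] A]
      assoc_mult_mat[OF P W(1) L] by simp
  show "Pi_proj A P R \<in> carrier_mat n n" unfolding Pi using P WL by simp
  have "?W * ?L * (P * (?W * ?L)) = ?W * (?L * P) * (?W * ?L)"
    using assoc_mult_mat[OF WL P WL] assoc_mult_mat[OF W(1) L P] by simp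
  also have "\<dots> = ?W * ?L" unfolding W(3) using left_mult_one_mat[OF WL] .
  finally have "?W * ?L * (P * (?W * ?L)) = ?W * ?L" .
  then show "Pi_proj A P R * Pi_proj A P R = Pi_proj A P R"
    unfolding Pi using assoc_mult_mat[OF P WL mult_carrier_mat[OF P WL]] by simp
qed

theorem theorem3p13:
  fixes A M B P R :: "complex mat" and n nc \<nu> :: nat
  assumes A: "A \<in> carrier_mat n n" "invertible_mat A"
    and M: "M \<in> carrier_mat n n" "invertible_mat M"
    and B: "B \<in> carrier_mat n n" "hpd B"
    and nc: "nc < n"
    and P: "P \<in> carrier_mat n nc"
    and R: "R \<in> carrier_mat n nc"
    and RAP: "invertible_mat (mat_adjoint R * A * P)"
    and contr: "mat_norm_B B (1\<^sub>m n - mat_inv M * A) < 1"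
    and normal: "normal_B B (mat_inv M * A)"
    and nonsing: "invertible_mat (1\<^sub>m n - mat_inv M * A)"
    and Pi_orth: "orthogonal_B B (Pi_proj A P R)"
    and Pi_nonzero: "Pi_proj A P R \<noteq> 0\<^sub>m n n"
    and Pi_not_id: "Pi_proj A P R \<noteq> 1\<^sub>m n"
    and nu: "\<nu> \<ge> 1"
  defines "X \<equiv> Xhat_inv A M B \<nu>"
  defines "K \<equiv> X * B * (1\<^sub>m n - Pi_proj A P R)"
  shows "mat_norm_B B (err_prop A M P R \<nu> \<nu>) = (mat_norm_B B (err_prop A M P R \<nu> 0))\<^sup>2
    \<and> (mat_norm_B B (err_prop A M P R \<nu> 0))\<^sup>2 = (mat_norm_B B (err_prop A M P R 0 \<nu>))\<^sup>2
    \<and> (mat_norm_B B (err_prop A M P R 0 \<nu>))\<^sup>2 = 1 - lambda_min_pos K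
    \<and> X * B = 1\<^sub>m n - (1\<^sub>m n - Mhat_inv A M B * B) ^\<^sub>m \<nu>
    \<and> complex_of_real (lambda_min_pos K) \<in> spectrum K
    \<and> 0 < lambda_min_pos K \<and> lambda_min_pos K < 1
    \<and> orthogonal_B B (X * B)
    \<and> hpd X
    \<and> spectrum K \<subseteq> complex_of_real ` {0..<1}"
proof -
  interpret hpd_form B n using B by unfold_locales
  have n: "0 < n" using nc by simp
  note Mi = mat_inv_carrier[OF M]
  define N where "N = mat_inv M * A"
  define G where "G = 1\<^sub>m n - N"
  define S where "S = G ^\<^sub>m \<nu>"
  define Q where "Q = 1\<^sub>m n - Pi_proj A P R"
  define Y where "Y = 1\<^sub>m n - adjoint_B B S * S"
  have N: "N \<in> carrier_mat n n" unfolding N_def using Mi A(1) by simp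
  have G: "G \<in> carrier_mat n n" unfolding G_def using N by simp
  have S: "S \<in> carrier_mat n n" unfolding S_def using G by simp
  have Y: "Y \<in> carrier_mat n n" unfolding Y_def using S by simp

  have normalG: "normal_B B G"
  proof -
    have "N * adjoint_B B N = adjoint_B B N * N"
      using normal unfolding normal_B_def N_def .
    moreover have "N + adjoint_B B N = adjoint_B B N + N"
      using N by (intro comm_add_mat) auto
    ultimately show ?thesis
      unfolding normal_B_def G_def adjoint_B_minus[OF one_carrier_mat N] adjoint_B_one
        one_minus_mult_one_minus[OF N adjoint_B_carrier[OF N]]
        one_minus_mult_one_minus[OF adjoint_B_carrier[OF N] N] by simp
  qed
  have normalS: "normal_B B S" unfolding S_def by (rule normal_B_pow(1)[OF G normalG])

  have contrG: "nrm (G *\<^sub>v x) < nrm x" if x: "x \<in> carrier_vec n" "x \<noteq> 0\<^sub>v n" for x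
  proof -
    have "nrm (G *\<^sub>v x) \<le> mat_norm_B B G * nrm x" by (rule nrm_mult_le[OF G x(1) n])
    also have "\<dots> < 1 * nrm x"
      using contr nrm_pos[OF x] unfolding G_def N_def by (intro mult_strict_right_mono)
    finally show ?thesis by simp
  qed
  have contrS: "nrm (S *\<^sub>v x) < nrm x" if x: "x \<in> carrier_vec n" "x \<noteq> 0\<^sub>v n" for x
    using strict_contraction_pow[OF G contrG x, of "\<nu> - 1"] nu unfolding S_def by simp

  have injG: "x = 0\<^sub>v n" if x: "x \<in> carrier_vec n" "G *\<^sub>v x = 0\<^sub>v n" for x
  proof -
    have inv: "invertible_mat G" using nonsing unfolding G_def N_def .
    note Gi = mat_inv[OF G inv]
    have "x = mat_inv G *\<^sub>v (G *\<^sub>v x)"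
      using mult_mult_vec[OF Gi(1) G x(1)] Gi(3) x(1) by simp
    also have "\<dots> = 0\<^sub>v n" unfolding x(2) using Gi(1) by auto
    finally show ?thesis .
  qed
  have injS: "x = 0\<^sub>v n" if x: "x \<in> carrier_vec n" "S *\<^sub>v x = 0\<^sub>v n" for x
    using pow_mat_injective[OF G injG x(1), of \<nu>] x(2) unfolding S_def by simp

  note Pi = Pi_proj_idem[OF A(1) P R RAP]
  have Q: "Q \<in> carrier_mat n n" unfolding Q_def using Pi by simp
  have Qsa: "orthogonal_B B Q"
    using Pi_orth unfolding orthogonal_B_def Q_def adjoint_B_minus[OF one_carrier_mat Pi(1)] adjoint_B_one
    by simp
  have Qidem: "Q * Q = Q"
    unfolding Q_def one_minus_mult_one_minus[OF Pi(1) Pi(1)] Pi(2)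
    using Pi(1) by (intro eq_matI) auto
  have Q0: "Q \<noteq> 0\<^sub>m n n"
  proof
    assume "Q = 0\<^sub>m n n"
    then have "1\<^sub>m n - Q = 1\<^sub>m n" by (auto intro!: eq_matI)
    moreover have "1\<^sub>m n - Q = Pi_proj A P R" unfolding Q_def using Pi(1) by (intro eq_matI) auto
    ultimately show False using Pi_not_id by simp
  qed

  have Z: "1\<^sub>m n - Mhat_inv A M B * B = G * adjoint_B B G"
    unfolding G_def N_def by (rule one_minus_Mhat_inv[OF A(1) Mi])
  have Zpow: "(1\<^sub>m n - Mhat_inv A M B * B) ^\<^sub>m \<nu> = adjoint_B B S * S"
    unfolding Z S_def normal_B_pow(2)[OF G normalG] ..
  have X: "X = Y * mat_inv B"
    unfolding X_def Xhat_inv_def Y_def Zpow[symmetric] using A(1) by simp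
  have XB: "X * B = Y"
    unfolding X using mult_assoc[OF Y B_inv(1) B_carrier] Y by simp
  have Ysa: "orthogonal_B B Y"
    using orthogonal_B_adjoint_mult[OF S]
    unfolding orthogonal_B_def Y_def adjoint_B_minus[OF one_carrier_mat mult_mat_closed[OF adjoint_B_carrier[OF S] S]]
      adjoint_B_one by simp
  have hpdX: "hpd X"
    unfolding X
  proof (rule hpd_mult_inv_B[OF Y Ysa])
    fix z :: "complex vec" assume z: "z \<in> carrier_vec n" "z \<noteq> 0\<^sub>v n"
    have "(nrm (S *\<^sub>v z))\<^sup>2 < (nrm z)\<^sup>2"
      using contrS[OF z] S z by (intro power_strict_mono) auto
    then show "0 < ip (Y *\<^sub>v z) z"
      unfolding Y_def ip_one_minus_adjoint_mult[OF S z(1)] by (simp add: less_complex_def)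
  qed

  have K: "K = (1\<^sub>m n - adjoint_B B S * S) * Q"
    unfolding K_def XB Y_def Q_def ..
  interpret C: compressed_contraction B n S Q
    using n S contrS injS Q Qsa Qidem by unfold_locales
  note core = C.compressed_smallest_eigenvalue[OF Q0, folded K]
  note lam = C.lambda_min_pos_compressed[OF Q0, folded K]
  have sq: "0 < (mat_norm_B B (S * Q))\<^sup>2" "(mat_norm_B B (S * Q))\<^sup>2 < 1"
    using core by (auto simp: power_less_one_iff)
  have spec: "spectrum K \<subseteq> complex_of_real ` {0..<1}"
  proof
    fix k assume k: "k \<in> spectrum K"
    show "k \<in> complex_of_real ` {0..<1}"
    proof (cases "k = 0")
      case False
      then obtain r where "k = complex_of_real r" "1 - (mat_norm_B B (S * Q))\<^sup>2 \<le> r" "r < 1"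
        using C.compressed_nonzero_eigenvalue[of k] k unfolding K by blast
      then show ?thesis using sq by auto
    qed (auto intro!: image_eqI[of _ _ 0])
  qed

  have smoother: "smoother A M = G" unfolding smoother_def G_def N_def using A(1) by simp
  have QA: "1\<^sub>m (dim_row A) - Pi_proj A P R = Q" unfolding Q_def using A(1) by simp
  have E: "err_prop A M P R \<nu> \<nu> = S * Q * S" "err_prop A M P R \<nu> 0 = Q * S"
    "err_prop A M P R 0 \<nu> = S * Q"
    unfolding err_prop_def smoother QA S_def[symmetric] using G S Q by auto
  note norms = normal_B_projection_norms[OF S normalS n Q Qsa Qidem]
  show ?thesis
    unfolding E norms lam XB Zpow Y_def[symmetric] using core sq Ysa hpdX spec by simp
qed

end
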